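(* Let $E/F$ be an unramified quadratic extension of non-archimedean local fields of characteristic zero, and let $\Gamma_n\subset U$ ($n\geqslant 0$) be the Miyauchi subgroups of the rank $3$ unitary group $U$ attached to $E/F$. Let $\mathrm{vol}$ be the Haar measure on $U$ normalized so that $\mathrm{vol}(\Gamma_0)=1$. Then for every $n\geqslant 1$, $$\mathrm{vol}(\Gamma_n)=q_F^{-3n}\,(1+q_F^{-3})^{-1}.$$
   Context: Let $E/F$ be an unramified quadratic extension of non-archimedean local fields of characteristic zero; $x\mapsto\overline{x}$ denotes the nontrivial element of $\mathrm{Gal}(E/F)$, applied entrywise to matrices. Let $\mathfrak{O}$ be the ring of integers of $E$, $\mathfrak{P}$ its maximal ideal, and let $q_F$ be the cardinality of the residue field of $F$. Let $$J=\begin{pmatrix}0&0&1\\0&1&0\\1&0&0\end{pmatrix},\qquad U=\{g\in \mathrm{GL}_3(E): {}^t\overline{g}Jg=J\},$$ a locally compact topological group. For $n\geqslant 0$ the Miyauchi subgroup $\Gamma_n$ is the compact open subgroup of $U$ $$\Gamma_n=\left\{g\in\begin{pmatrix}\mathfrak{O}&\mathfrak{O}&\mathfrak{P}^{-n}\\ \mathfrak{P}^n&1+\mathfrak{P}^n&\mathfrak{O}\\ \mathfrak{P}^n&\mathfrak{P}^n&\mathfrak{O}\end{pmatrix}:\det(g)\in\mathfrak{O}^\times\right\}\cap U,$$ where the displayed matrix of sets means that each entry of $g$ lies in the set in the corresponding position (for $n=0$, $1+\mathfrak{P}^0=\mathfrak{O}$). *)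

theory Defs
  imports "HOL-Analysis.Analysis"
begin

text \<open>
  A non-archimedean local field is a field that is complete with respect to a discrete
  (and nontrivial) non-archimedean absolute value, with finite residue field. The absolute
  value is a new operation because the library's norm is constrained to real normed vector
  spaces. It need not be normalized; the metric and the topology are the ones it induces.
\<close>

class complete_discretely_valued_field = field + complete_space +
  fixes absval :: "'a \<Rightarrow> real"
  assumes dist_absval: "dist x y = absval (x - y)"
    and absval_mult: "absval (x * y) = absval x * absval y"
    and absval_ultrametric: "absval (x + y) \<le> max (absval x) (absval y)"
    and absval_discrete:
      "\<exists>\<pi>. 0 < absval \<pi> \<and> absval \<pi> < 1 \<and> (\<forall>x. x \<noteq> 0 \<longrightarrow> (\<exists>k::int. absval x = absval \<pi> powi k))"
begin

definition valuation_ring :: "'a set" where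
  "valuation_ring = {x. absval x \<le> 1}"

definition maximal_ideal :: "'a set" where
  "maximal_ideal = {x. absval x < 1}"

definition residue_field :: "'a set set" where
  "residue_field =
     valuation_ring // {(x, y). x \<in> valuation_ring \<and> y \<in> valuation_ring \<and> x - y \<in> maximal_ideal}"

end

class nonarch_local_field = complete_discretely_valued_field +
  assumes finite_residue_field: "finite residue_field"

definition residue_card :: "'a::nonarch_local_field itself \<Rightarrow> nat" where
  "residue_card _ = card (residue_field :: 'a set set)"

definition uniformizer :: "'a::nonarch_local_field \<Rightarrow> bool" where
  "uniformizer \<pi> \<longleftrightarrow> maximal_ideal = (*) \<pi> ` valuation_ring"

text \<open>
  The fractional ideal that is the \<open>k\<close>-th power of the maximal ideal; the existential
  quantifier over uniformizers is harmless since two uniformizers differ by a unit.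
\<close>

definition maximal_ideal_power :: "int \<Rightarrow> 'a::nonarch_local_field set" where
  "maximal_ideal_power k = {\<pi> powi k * y | \<pi> y. uniformizer \<pi> \<and> y \<in> valuation_ring}"

definition valuation_ring_units :: "'a::nonarch_local_field set" where
  "valuation_ring_units = {x \<in> valuation_ring. \<exists>y \<in> valuation_ring. x * y = 1}"

definition field_embedding :: "('f::field \<Rightarrow> 'e::field) \<Rightarrow> bool" where
  "field_embedding \<iota> \<longleftrightarrow>
     \<iota> 1 = 1 \<and> (\<forall>x y. \<iota> (x + y) = \<iota> x + \<iota> y) \<and> (\<forall>x y. \<iota> (x * y) = \<iota> x * \<iota> y)"

definition extension_degree :: "('f::field \<Rightarrow> 'e::field) \<Rightarrow> nat" where
  "extension_degree \<iota> = vector_space.dim (\<lambda>a x. \<iota> a * x) UNIV"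

definition local_field_extension :: "('f::nonarch_local_field \<Rightarrow> 'e::nonarch_local_field) \<Rightarrow> bool" where
  "local_field_extension \<iota> \<longleftrightarrow> field_embedding \<iota> \<and> (\<forall>a. absval (\<iota> a) = absval a)"

text \<open>
  An extension is unramified if its ramification index, the index of the value groups, is
  1 and the extension of residue fields is separable; the latter is automatic because the
  residue fields are finite.
\<close>

definition unramified :: "('f::nonarch_local_field \<Rightarrow> 'e::nonarch_local_field) \<Rightarrow> bool" where
  "unramified \<iota> \<longleftrightarrow> local_field_extension \<iota> \<and> absval ` (UNIV - {0 :: 'e}) = absval ` (UNIV - {0 :: 'f})"

definition unramified_quadratic ::
    "('f::nonarch_local_field \<Rightarrow> 'e::nonarch_local_field) \<Rightarrow> bool" where
  "unramified_quadratic \<iota> \<longleftrightarrow> unramified \<iota> \<and> extension_degree \<iota> = 2"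

definition galois_group :: "('f::field \<Rightarrow> 'e::field) \<Rightarrow> ('e \<Rightarrow> 'e) set" where
  "galois_group \<iota> = {\<sigma>. bij \<sigma> \<and> field_embedding \<sigma> \<and> (\<forall>a. \<sigma> (\<iota> a) = \<iota> a)}"

definition antidiag_J :: "'e::field^3^3" where
  "antidiag_J = vector [vector [0, 0, 1], vector [0, 1, 0], vector [1, 0, 0]]"

definition unitary_group :: "('e::field \<Rightarrow> 'e) \<Rightarrow> ('e^3^3) set" where
  "unitary_group \<sigma> =
     {g. invertible g \<and> transpose (map_matrix \<sigma> g) ** antidiag_J ** g = antidiag_J}"

definition miyauchi_subgroup :: "('e::nonarch_local_field \<Rightarrow> 'e) \<Rightarrow> nat \<Rightarrow> ('e^3^3) set" where
  "miyauchi_subgroup \<sigma> n =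
     {g. g $ 1 $ 1 \<in> valuation_ring \<and>
         g $ 1 $ 2 \<in> valuation_ring \<and>
         g $ 1 $ 3 \<in> maximal_ideal_power (- int n) \<and>
         g $ 2 $ 1 \<in> maximal_ideal_power (int n) \<and>
         g $ 2 $ 2 \<in> (+) 1 ` maximal_ideal_power (int n) \<and>
         g $ 2 $ 3 \<in> valuation_ring \<and>
         g $ 3 $ 1 \<in> maximal_ideal_power (int n) \<and>
         g $ 3 $ 2 \<in> maximal_ideal_power (int n) \<and>
         g $ 3 $ 3 \<in> valuation_ring \<and>
         det g \<in> valuation_ring_units}
     \<inter> unitary_group \<sigma>"

text \<open>
  Left Haar measures on a locally compact Hausdorff group whose underlying space is a
  subspace \<open>G\<close> of an ambient topological space: nonzero left-invariant Radon measures on the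
  Borel sets of \<open>G\<close>. For the unitary group above, the ambient space is the space of all
  3 by 3 matrices with the product topology, which induces the usual topology of the general
  linear group.
\<close>

definition left_haar_measure ::
    "'a::topological_space set \<Rightarrow> ('a \<Rightarrow> 'a \<Rightarrow> 'a) \<Rightarrow> 'a measure \<Rightarrow> bool" where
  "left_haar_measure G m M \<longleftrightarrow>
     sets M = sets (restrict_space borel G) \<and>
     (\<forall>g \<in> G. \<forall>A \<in> sets M. emeasure M (m g ` A) = emeasure M A) \<and>
     emeasure M G \<noteq> 0 \<and>
     (\<forall>K. K \<subseteq> G \<and> compact K \<longrightarrow> emeasure M K < \<infinity>) \<and>
     (\<forall>A \<in> sets M. emeasure M A = (INF V \<in> {V. openin (top_of_set G) V \<and> A \<subseteq> V}. emeasure M V)) \<and>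
     (\<forall>V. openin (top_of_set G) V \<longrightarrow>
        emeasure M V = (SUP K \<in> {K. compact K \<and> K \<subseteq> V}. emeasure M K))"

end

(*
  Gamma_0 and Gamma_n are both disjoint unions of translates of common subgroups, so only numbers
  of cosets matter. Let K_n be the subgroup of Gamma_0 that is upper triangular modulo P^n, and
  H_n the intersection of Gamma_0 and Gamma_n, i.e. the elements of K_n with middle entry 1 modulo P^n.

  Cosets of K_n in Gamma_0 are isotropic lines modulo P^n, represented by lower unipotent matrices
  and by Weyl translates of those that are trivial modulo P. Writing O_E = O_F + O_F w, the lower
  unipotent matrices are parametrized by O_F^3, so the index is q^(3n) + q^(3n-3).

  The indices of H_n in K_n and in Gamma_n need not be computed, because both are the number of
  points of the projective line over O_F / P_F^n: in K_n by Hilbert 90, which writes a norm-one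
  middle entry as z / conj z, and in Gamma_n because its outer 2 by 2 block is SL_2 up to
  conjugation. Hence vol(Gamma_n) = vol(K_n) = 1 / (q^(3n) + q^(3n-3)).
*)

theory Submission
  imports Defs
begin

section \<open>Absolute values\<close>

text \<open>The comparison passes through H_n because for n >= 1 neither of Gamma_0 and Gamma_n
  contains the other. The obstacle is residue characteristic 2, where 2 is not a unit and E does not
  split integrally into F and the elements of trace 0. The substitute is an integral w for which d =
  w - conj w is a unit. Then w / d has trace 1 and d has trace 0, so the isotropy equation y + conj
  y + x conj x = 0 is solved by two coordinates of x and one free multiple of d: hence the exponent
  3. The same d turns the Hermitian condition on the outer block into determinant 1 over F, and it
  bounds the distance of an element from F by how far conj moves it. That d is a unit rests on the
  finite residue field being perfect: otherwise w would reduce to a double root of its quadratic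
  equation, and such a root already lies in the residue field of F.\<close>

lemma absval_nonneg [simp]: "0 \<le> absval x"
  using dist_absval[of x 0] by (metis diff_zero zero_le_dist)

lemma absval_eq_0_iff [simp]: "absval x = 0 \<longleftrightarrow> x = 0"
  using dist_absval[of x 0] by (metis diff_zero dist_eq_0_iff)

lemma absval_0 [simp]: "absval (0 :: 'a::complete_discretely_valued_field) = 0"
  by simp

lemma absval_pos_iff [simp]: "0 < absval x \<longleftrightarrow> x \<noteq> 0"
  using absval_nonneg[of x] absval_eq_0_iff[of x] by linarith

lemma absval_1 [simp]: "absval (1 :: 'a::complete_discretely_valued_field) = 1"
  using absval_mult[of "1::'a" 1] absval_eq_0_iff[of "1::'a"] by auto

lemma absval_minus_commute: "absval (x - y) = absval (y - x)"
  by (metis dist_absval dist_commute)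

lemma absval_minus [simp]: "absval (- x) = absval x"
  using absval_minus_commute[of 0 x] by simp

lemma absval_power: "absval (x ^ k) = absval x ^ k"
  by (induction k) (simp_all add: absval_mult)

lemma absval_inverse: "absval (inverse x) = inverse (absval x)"
proof (cases "x = 0")
  case False
  then have "absval x * absval (inverse x) = 1"
    using absval_mult[of x "inverse x"] by simp
  then show ?thesis
    using inverse_unique by metis
qed simp

lemma absval_divide: "absval (x / y) = absval x / absval y"
  by (simp add: divide_inverse absval_mult absval_inverse)

lemma absval_powi: "absval (x powi k) = absval x powi k"
  by (cases "k \<ge> 0") (simp_all add: power_int_def absval_power absval_inverse)

lemma absval_add_le: "absval x \<le> e \<Longrightarrow> absval y \<le> e \<Longrightarrow> absval (x + y) \<le> e"
  using absval_ultrametric[of x y] by linarith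

lemma absval_diff_le: "absval x \<le> e \<Longrightarrow> absval y \<le> e \<Longrightarrow> absval (x - y) \<le> e"
  using absval_add_le[of x e "- y"] by simp

lemma absval_add_less: "absval x < e \<Longrightarrow> absval y < e \<Longrightarrow> absval (x + y) < e"
  using absval_ultrametric[of x y] by linarith

lemma absval_diff_less: "absval x < e \<Longrightarrow> absval y < e \<Longrightarrow> absval (x - y) < e"
  using absval_add_less[of x e "- y"] by simp

lemma absval_mult_le_left: "absval x \<le> 1 \<Longrightarrow> absval y \<le> e \<Longrightarrow> absval (x * y) \<le> e"
  by (simp add: absval_mult)
     (metis absval_nonneg mult_left_le_one_le order_trans)

lemma absval_mult_le_right: "absval x \<le> e \<Longrightarrow> absval y \<le> 1 \<Longrightarrow> absval (x * y) \<le> e"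
  by (metis absval_mult_le_left mult.commute)

lemma absval_mult_less_left: "absval x \<le> 1 \<Longrightarrow> absval y < e \<Longrightarrow> absval (x * y) < e"
  by (meson absval_mult_le_left order_refl order_le_less_trans)

lemma absval_mult_less_right: "absval x < e \<Longrightarrow> absval y \<le> 1 \<Longrightarrow> absval (x * y) < e"
  by (meson absval_mult_le_right order_refl order_le_less_trans)

lemma absval_add_eq_left:
  assumes "absval y < absval x"
  shows "absval (x + y) = absval x"
proof -
  have "absval x \<le> max (absval (x + y)) (absval y)"
    using absval_ultrametric[of "x + y" "- y"] by simp
  moreover have "absval (x + y) \<le> max (absval x) (absval y)"
    by (rule absval_ultrametric)
  ultimately show ?thesis
    using assms by (auto simp: max_def split: if_splits)
qed

lemma absval_add_eq_right: "absval x < absval y \<Longrightarrow> absval (x + y) = absval y"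
  by (metis absval_add_eq_left add.commute)

section \<open>Discreteness: values, uniformizers and fractional ideals\<close>

definition value_generator :: "'a::complete_discretely_valued_field \<Rightarrow> bool" where
  "value_generator p \<longleftrightarrow>
     0 < absval p \<and> absval p < 1 \<and> (\<forall>x::'a. x \<noteq> 0 \<longrightarrow> (\<exists>k::int. absval x = absval p powi k))"

lemma value_generator_powi:
  fixes p x :: "'a::complete_discretely_valued_field"
  shows "value_generator p \<Longrightarrow> x \<noteq> 0 \<Longrightarrow> \<exists>k::int. absval x = absval p powi k"
  unfolding value_generator_def by simp

lemma value_generator_less:
  fixes p x :: "'a::complete_discretely_valued_field"
  assumes "value_generator p" and "absval x < absval p powi k"
  shows "absval x \<le> absval p powi (k + 1)"
proof (cases "x = 0")
  case True
  then show ?thesis using assms by (simp add: value_generator_def)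
next
  case False
  then obtain j where j: "absval x = absval p powi j"
    using value_generator_powi[OF assms(1)] by blast
  have p: "0 < absval p" "absval p < 1"
    using assms by (auto simp: value_generator_def)
  have "k < j"
  proof (rule ccontr)
    assume "\<not> k < j"
    then have "absval p powi k \<le> absval p powi j"
      using p by (intro power_int_decreasing) auto
    then show False
      using assms(2) j by simp
  qed
  then have "absval p powi j \<le> absval p powi (k + 1)"
    using p by (intro power_int_decreasing) auto
  then show ?thesis
    using j by simp
qed

lemma value_generator_less_1:
  fixes p x :: "'a::complete_discretely_valued_field"
  shows "value_generator p \<Longrightarrow> absval x < 1 \<Longrightarrow> absval x \<le> absval p"
  using value_generator_less[of p x 0] by simp

lemma uniformizer_iff_absval_eq:
  fixes p u :: "'a::nonarch_local_field"
  assumes "value_generator p"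
  shows "uniformizer u \<longleftrightarrow> absval u = absval p"
proof
  have p: "0 < absval p" "absval p < 1"
    using assms by (auto simp: value_generator_def)
  {
    assume u: "uniformizer u"
    have "absval u < 1"
      using u by (auto simp: uniformizer_def maximal_ideal_def valuation_ring_def set_eq_iff image_iff)
         (metis absval_1 mult.right_neutral order_refl)
    moreover have "\<exists>y. p = u * y \<and> absval y \<le> 1"
      using u p by (auto simp: uniformizer_def maximal_ideal_def valuation_ring_def set_eq_iff image_iff)
    then have "absval p \<le> absval u"
      by (metis absval_mult_le_right order_refl)
    ultimately show "absval u = absval p"
      using value_generator_less_1[OF assms, of u] by simp
  next
    assume u: "absval u = absval p"
    then have u0: "u \<noteq> 0" "absval u > 0"
      using p by auto
    show "uniformizer u"
      unfolding uniformizer_def maximal_ideal_def valuation_ring_def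
    proof (intro set_eqI iffI)
      fix x :: 'a assume "x \<in> {x. absval x < 1}"
      then have "absval (x / u) \<le> 1"
        using value_generator_less_1[OF assms, of x] u u0 by (simp add: absval_divide)
      then show "x \<in> (*) u ` {x. absval x \<le> 1}"
        using u0 by (intro image_eqI[of _ _ "x / u"]) auto
    next
      fix x :: 'a assume "x \<in> (*) u ` {x. absval x \<le> 1}"
      then show "x \<in> {x. absval x < 1}"
        using u p by (auto intro!: absval_mult_less_right)
    qed
  }
qed

text \<open>All uniformizers have the absolute value of \<open>p\<close>, so the quantifier in
  \<open>maximal_ideal_power\<close> collapses and ideal membership becomes a bound.\<close>

lemma maximal_ideal_power_eq:
  fixes p :: "'a::nonarch_local_field"
  assumes "value_generator p"
  shows "maximal_ideal_power k = {x :: 'a. absval x \<le> absval p powi k}"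
proof -
  have p: "0 < absval p" "p \<noteq> 0"
    using assms by (auto simp: value_generator_def)
  show ?thesis
    unfolding maximal_ideal_power_def uniformizer_iff_absval_eq[OF assms] valuation_ring_def
  proof (intro set_eqI iffI)
    fix x :: 'a assume "x \<in> {u powi k * y |u y. absval u = absval p \<and> y \<in> {x. absval x \<le> 1}}"
    then show "x \<in> {x. absval x \<le> absval p powi k}"
      by (auto simp: absval_powi intro!: absval_mult_le_right)
  next
    fix x :: 'a assume "x \<in> {x. absval x \<le> absval p powi k}"
    then have "absval (x / p powi k) \<le> 1"
      using p by (simp add: absval_divide absval_powi)
    moreover have "x = p powi k * (x / p powi k)"
      using p by simp
    ultimately show "x \<in> {u powi k * y |u y. absval u = absval p \<and> y \<in> {x. absval x \<le> 1}}"
      by blast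
  qed
qed

section \<open>Representatives of the ring of integers modulo an ideal given by a bound
  \<open>c\<close>\<close>

definition residue_system :: "'a::nonarch_local_field set \<Rightarrow> real \<Rightarrow> bool" where
  "residue_system S c \<longleftrightarrow> finite S \<and> (\<forall>s\<in>S. absval s \<le> 1) \<and>
     (\<forall>x. absval x \<le> 1 \<longrightarrow> (\<exists>s\<in>S. absval (x - s) \<le> c)) \<and>
     (\<forall>s\<in>S. \<forall>t\<in>S. absval (s - t) \<le> c \<longrightarrow> s = t)"

lemma residue_system_1:
  fixes p :: "'a::nonarch_local_field"
  assumes p: "value_generator p"
  obtains S :: "'a set" where "residue_system S (absval p)" "card S = residue_card TYPE('a)" "0 \<in> S"
proof -
  define rel where "rel = {(x::'a, y). x \<in> valuation_ring \<and> y \<in> valuation_ring \<and> x - y \<in> maximal_ideal}"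
  have rel: "(x, y) \<in> rel \<longleftrightarrow> absval x \<le> 1 \<and> absval y \<le> 1 \<and> absval (x - y) \<le> absval p" for x y
    using value_generator_less_1[OF p, of "x - y"] p
    by (auto simp: rel_def valuation_ring_def maximal_ideal_def value_generator_def)
  have eq: "equiv valuation_ring rel"
  proof (rule equivI)
    show "rel \<subseteq> valuation_ring \<times> valuation_ring"
      by (auto simp: rel_def)
    show "refl_on valuation_ring rel"
      by (auto simp: refl_on_def rel_def maximal_ideal_def)
    show "sym rel"
      by (auto simp: sym_def rel absval_minus_commute)
    show "trans rel"
    proof (rule transI)
      fix x y z assume "(x, y) \<in> rel" "(y, z) \<in> rel"
      then show "(x, z) \<in> rel"
        using absval_add_le[of "x - y" "absval p" "y - z"] by (auto simp: rel)
    qed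
  qed
  define Q where "Q = valuation_ring // rel"
  have Q: "finite Q" "card Q = residue_card TYPE('a)"
    using finite_residue_field by (auto simp: Q_def rel_def residue_card_def residue_field_def)
  \<comment> \<open>The class of 0 gets the representative 0, so that 0 is the only representative
    of absolute value below 1; the count of small representatives rests on this.\<close>
  define f where "f X = (if 0 \<in> X then 0 else SOME x :: 'a. x \<in> X)" for X
  have f: "f X \<in> X" if "X \<in> Q" for X
    using that in_quotient_imp_non_empty[OF eq, of X] some_in_eq[of X] by (auto simp: f_def Q_def)
  have frel: "(x, f X) \<in> rel" if "X \<in> Q" "x \<in> X" for x X
    using that f quotient_eq_iff[OF eq, of X X x "f X"] by (simp add: Q_def)
  have inj: "inj_on f Q"
  proof (rule inj_onI)
    fix X Y assume XY: "X \<in> Q" "Y \<in> Q" "f X = f Y"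
    then show "X = Y"
      using quotient_eq_iff[OF eq, of X Y "f X" "f Y"] f[OF XY(1)] f[OF XY(2)] frel[OF XY(1) f[OF XY(1)]]
      by (simp add: Q_def)
  qed
  have cl: "rel `` {x} \<in> Q" "x \<in> rel `` {x}" if "absval x \<le> 1" for x
    using that eq by (auto simp: Q_def quotientI valuation_ring_def rel)
  show thesis
  proof (rule that[of "f ` Q"])
    show "card (f ` Q) = residue_card TYPE('a)"
      using inj Q by (simp add: card_image)
    have "f (rel `` {0}) = 0"
      using cl[of 0] by (simp add: f_def)
    then show "0 \<in> f ` Q"
      using cl[of 0] by (metis absval_0 image_eqI zero_le_one)
    show "residue_system (f ` Q) (absval p)"
      unfolding residue_system_def
    proof (intro conjI ballI allI impI)
      show "finite (f ` Q)"
        using Q by simp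
    next
      fix s assume "s \<in> f ` Q"
      then show "absval s \<le> 1"
        using frel f rel by blast
    next
      fix x :: 'a assume "absval x \<le> 1"
      then show "\<exists>s\<in>f ` Q. absval (x - s) \<le> absval p"
        using cl frel rel by blast
    next
      fix s t assume "s \<in> f ` Q" "t \<in> f ` Q" and st: "absval (s - t) \<le> absval p"
      then obtain X Y where XY: "X \<in> Q" "Y \<in> Q" "s = f X" "t = f Y"
        by blast
      then have "(s, t) \<in> rel"
        using frel[OF XY(1) f[OF XY(1)]] frel[OF XY(2) f[OF XY(2)]] st XY by (simp add: rel)
      then have "X = Y"
        using XY f quotient_eq_iff[OF eq, of X Y "f X" "f Y"] by (simp add: Q_def)
      then show "s = t"
        using XY by simp
    qed
  qed
qed

text \<open>Digit expansion: a representative modulo one more power is \<open>r + p * s\<close> with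
  lowest digit \<open>r\<close> and an old representative \<open>s\<close>. It has absolute value
  below 1 exactly when \<open>r = 0\<close>, whence the exponent \<open>n\<close> in the last
  count.\<close>

lemma residue_system_power:
  fixes p :: "'a::nonarch_local_field"
  assumes p: "value_generator p"
  obtains S :: "'a set" where "residue_system S (absval p ^ Suc n)"
    "card S = residue_card TYPE('a) ^ Suc n" "card {s \<in> S. absval s < 1} = residue_card TYPE('a) ^ n"
proof -
  let ?q = "residue_card TYPE('a)"
  have p1: "0 < absval p" "absval p < 1" "p \<noteq> 0"
    using p by (auto simp: value_generator_def)
  obtain R :: "'a set" where R: "residue_system R (absval p)" "card R = ?q" "0 \<in> R"
    using residue_system_1[OF p] .
  have R1: "absval r < 1 \<Longrightarrow> r \<in> R \<Longrightarrow> r = 0" for r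
    using value_generator_less_1[OF p, of r] R by (auto simp: residue_system_def)
  have step: "\<exists>S'::'a set. residue_system S' (absval p * c) \<and> card S' = ?q * card S \<and>
      card {s \<in> S'. absval s < 1} = card S" if S: "residue_system S c" "c \<le> 1" for S :: "'a set" and c
  proof -
    define f where "f = (\<lambda>(r, s). r + p * s)"
    have ps: "absval (p * s) < 1" if "absval s \<le> 1" for s
      using that p1 by (intro absval_mult_less_right) auto
    have key: "r = r' \<and> s = s'"
      if rs: "r \<in> R" "r' \<in> R" "s \<in> S" "s' \<in> S" "absval (f (r, s) - f (r', s')) \<le> absval p * c"
      for r r' s s' :: 'a
    proof -
      have b: "absval s \<le> 1" "absval s' \<le> 1"
        using S rs by (auto simp: residue_system_def)
      have "absval p * c \<le> absval p"
        using p1 \<open>c \<le> 1\<close> by (simp add: mult_left_le)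
      then have "absval (f (r, s) - f (r', s')) \<le> absval p"
        using rs by linarith
      moreover have "absval (p * (s' - s)) \<le> absval p"
        using b by (intro absval_mult_le_right absval_diff_le) auto
      ultimately have "absval ((f (r, s) - f (r', s')) + p * (s' - s)) \<le> absval p"
        by (rule absval_add_le)
      then have "absval (r - r') \<le> absval p"
        by (simp add: f_def algebra_simps)
      then have r: "r = r'"
        using R rs by (auto simp: residue_system_def)
      have "absval (p * (s - s')) \<le> absval p * c"
        using rs(5) r by (simp add: f_def algebra_simps)
      then have "absval (s - s') \<le> c"
        using p1 by (simp add: absval_mult)
      then show ?thesis
        using S rs r by (auto simp: residue_system_def)
    qed
    \<comment> \<open>Covering 0 forces \<open>c\<close> to be nonnegative, so that equal values of
      \<open>f\<close> count as close in \<open>key\<close>.\<close>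
    have "\<forall>x. absval x \<le> 1 \<longrightarrow> (\<exists>s\<in>S. absval (x - s) \<le> c)"
      using S by (simp add: residue_system_def)
    from this[rule_format, of 0] obtain s :: 'a where "absval (0 - s) \<le> c"
      by auto
    then have c0: "0 \<le> c"
      using absval_nonneg[of "0 - s"] by linarith
    have inj: "inj_on f (R \<times> S)"
    proof (rule inj_onI)
      fix x y assume "x \<in> R \<times> S" "y \<in> R \<times> S" "f x = f y"
      then show "x = y"
        using key[of "fst x" "fst y" "snd x" "snd y"] c0 p1 by (auto simp: prod_eq_iff)
    qed
    have small: "{s \<in> f ` (R \<times> S). absval s < 1} = f ` ({0} \<times> S)"
    proof (intro set_eqI iffI)
      fix x assume "x \<in> {s \<in> f ` (R \<times> S). absval s < 1}"
      then obtain r s where rs: "r \<in> R" "s \<in> S" "x = r + p * s" "absval x < 1"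
        by (auto simp: f_def)
      have "absval (p * s) < 1"
        using rs S ps by (auto simp: residue_system_def)
      then have "absval r < 1"
        using absval_diff_less[of x 1 "p * s"] rs by simp
      then show "x \<in> f ` ({0} \<times> S)"
        using R1 rs by (auto simp: f_def)
    next
      fix x assume "x \<in> f ` ({0} \<times> S)"
      then obtain s where "s \<in> S" "x = f (0, s)" "absval s \<le> 1"
        using S by (auto simp: residue_system_def)
      then show "x \<in> {s \<in> f ` (R \<times> S). absval s < 1}"
        using ps[of s] R(3) image_eqI[of x f "(0, s)" "R \<times> S"] by (auto simp: f_def)
    qed
    have "residue_system (f ` (R \<times> S)) (absval p * c)"
      unfolding residue_system_def
    proof (intro conjI ballI allI impI)
      show "finite (f ` (R \<times> S))"
        using R S by (simp add: residue_system_def)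
    next
      fix x assume "x \<in> f ` (R \<times> S)"
      then obtain r s where "r \<in> R" "s \<in> S" "x = r + p * s" "absval r \<le> 1" "absval s \<le> 1"
        using R S by (auto simp: residue_system_def f_def)
      then show "absval x \<le> 1"
        using ps[of s] by (auto intro!: absval_add_le)
    next
      fix x :: 'a assume "absval x \<le> 1"
      then obtain r where r: "r \<in> R" "absval (x - r) \<le> absval p"
        using R by (auto simp: residue_system_def)
      have "absval ((x - r) / p) \<le> 1"
        using r p1 by (simp add: absval_divide)
      then obtain s where s: "s \<in> S" "absval ((x - r) / p - s) \<le> c"
        using S by (auto simp: residue_system_def)
      have "x - (r + p * s) = p * ((x - r) / p - s)"
        using p1 by (simp add: field_simps)
      then have "absval (x - (r + p * s)) \<le> absval p * c"
        using s p1 by (simp add: absval_mult)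
      then show "\<exists>s\<in>f ` (R \<times> S). absval (x - s) \<le> absval p * c"
        using r s by (auto simp: f_def)
    next
      fix x y assume "x \<in> f ` (R \<times> S)" "y \<in> f ` (R \<times> S)" "absval (x - y) \<le> absval p * c"
      then show "x = y"
        using key by blast
    qed
    moreover have "card (f ` (R \<times> S)) = ?q * card S"
      using inj R by (simp add: card_image card_cartesian_product)
    moreover have "card (f ` ({0} \<times> S)) = card S"
      using inj_on_subset[OF inj, of "{0} \<times> S"] R by (subst card_image) (auto simp: card_cartesian_product)
    ultimately show ?thesis
      using small by metis
  qed
  \<comment> \<open>One application of \<open>step\<close> is kept for the end: the induction tracks
    sizes only, and the final application supplies the count of small representatives.\<close>
  have "\<exists>S::'a set. residue_system S (absval p ^ n) \<and> card S = ?q ^ n"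
  proof (induction n)
    case 0
    have "residue_system {0::'a} (absval p ^ 0)"
      by (auto simp: residue_system_def)
    then show ?case
      by (intro exI[of _ "{0}"]) auto
  next
    case (Suc n)
    then obtain S :: "'a set" where S: "residue_system S (absval p ^ n)" "card S = ?q ^ n"
      by blast
    have "absval p ^ n \<le> 1"
      using p1 by (simp add: power_le_one)
    then show ?case
      using step[OF S(1)] S(2) by auto
  qed
  then obtain S :: "'a set" where S: "residue_system S (absval p ^ n)" "card S = ?q ^ n"
    by blast
  have "absval p ^ n \<le> 1"
    using p1 by (simp add: power_le_one)
  then show thesis
    using step[OF S(1)] S(2) that by auto
qed

section \<open>Unramified quadratic extensions\<close>

text \<open>\<open>absval_decomposition\<close> says that \<open>1\<close> and \<open>w\<close> form
  an integral basis and \<open>absval_discriminant\<close> that its discriminant is a unit, so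
  bounds on elements of E become bounds on two coordinates in F. A single \<open>p\<close> generates
  both value groups, so the same \<open>c\<close> measures congruences in both fields.\<close>

locale unramified_involution =
  fixes \<iota> :: "'f::nonarch_local_field \<Rightarrow> 'e::nonarch_local_field"
    and \<sigma> :: "'e \<Rightarrow> 'e"
    and w :: 'e
    and p :: 'f
  assumes embedding: "field_embedding \<iota>"
    and absval_embedding [simp]: "absval (\<iota> a) = absval a"
    and conj_hom: "field_embedding \<sigma>"
    and absval_conj [simp]: "absval (\<sigma> x) = absval x"
    and conj_conj [simp]: "\<sigma> (\<sigma> x) = x"
    and conj_embedding [simp]: "\<sigma> (\<iota> a) = \<iota> a"
    and fixed_point: "\<sigma> x = x \<Longrightarrow> \<exists>a. x = \<iota> a"
    and decomposition: "\<exists>a b. x = \<iota> a + \<iota> b * w"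
    and absval_decomposition: "absval (\<iota> a + \<iota> b * w) = max (absval a) (absval b)"
    and absval_discriminant: "absval (w - \<sigma> w) = 1"
    and generator_p: "value_generator p"
    and generator_\<iota>p: "value_generator (\<iota> p)"

lemma field_embedding_simps:
  assumes "field_embedding f"
  shows "f 0 = 0" "f 1 = 1" "f (x + y) = f x + f y" "f (x * y) = f x * f y"
    "f (- x) = - f x" "f (x - y) = f x - f y" "f (inverse x) = inverse (f x)"
    "f (x / y) = f x / f y" "f (x ^ n) = f x ^ n"
proof -
  have a: "f (x + y) = f x + f y" "f (x * y) = f x * f y" "f 1 = 1" for x y
    using assms by (auto simp: field_embedding_def)
  have 0: "f 0 = 0"
    using a(1)[of 0 0] by (metis add_cancel_right_left add_0)
  have m: "f (- x) = - f x" for x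
    using a(1)[of x "- x"] 0 by (simp add: eq_neg_iff_add_eq_0 add.commute)
  have i: "f (inverse x) = inverse (f x)" for x
    by (cases "x = 0") (use 0 a(2)[of x "inverse x"] a(3) inverse_unique[of "f x" "f (inverse x)"] in auto)
  show "f 0 = 0" "f 1 = 1" "f (x + y) = f x + f y" "f (x * y) = f x * f y"
    "f (- x) = - f x" "f (inverse x) = inverse (f x)"
    by (fact 0 a m i)+
  show "f (x - y) = f x - f y"
    using a(1)[of x "- y"] m by simp
  show "f (x / y) = f x / f y"
    by (simp add: divide_inverse a i)
  show "f (x ^ n) = f x ^ n"
    by (induction n) (simp_all add: a)
qed

lemma field_embedding_eq_iff:
  assumes "field_embedding f"
  shows "f x = f y \<longleftrightarrow> x = y"
proof -
  have "f (x - y) \<noteq> 0" if "x \<noteq> y"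
    using that field_embedding_simps(4)[OF assms, of "x - y" "inverse (x - y)"]
      field_embedding_simps(2)[OF assms] by auto
  then show ?thesis
    using field_embedding_simps(6)[OF assms, of x y] by auto
qed

text \<open>
  The point \<open>w\<close> comes from an element of \<open>F\<close> closest to a given \<open>\<theta>\<close> outside \<open>F\<close>: completeness
  makes the distance positive, discreteness makes it attained, and equality of the value groups
  allows scaling it to 1.
\<close>

lemma exists_residue_independent:
  fixes \<iota> :: "'f::nonarch_local_field \<Rightarrow> 'e::nonarch_local_field"
  assumes ur: "unramified \<iota>" and \<theta>: "\<theta> \<notin> range \<iota>"
  obtains w where "absval w = 1" "\<And>a. absval (w - \<iota> a) \<ge> 1"
proof -
  have emb: "field_embedding \<iota>" and iso: "\<And>a. absval (\<iota> a) = absval a"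
    and vg: "absval ` (UNIV - {0 :: 'e}) = absval ` (UNIV - {0 :: 'f})"
    using ur by (auto simp: unramified_def local_field_extension_def)
  note hom = field_embedding_simps[OF emb]
  obtain u :: 'e where u: "value_generator u"
    using absval_discrete unfolding value_generator_def by blast
  have u1: "0 < absval u" "absval u < 1"
    using u by (auto simp: value_generator_def)
  have nz: "\<theta> - \<iota> a \<noteq> 0" for a
    using \<theta> by auto
  have "\<exists>N::nat. \<forall>a. absval u ^ N \<le> absval (\<theta> - \<iota> a)"
  proof (rule ccontr)
    assume "\<not> ?thesis"
    then have "\<forall>N. \<exists>a. absval (\<theta> - \<iota> a) < absval u ^ N"
      by (auto simp: not_le)
    then obtain a where a: "absval (\<theta> - \<iota> (a N)) < absval u ^ N" for N
      by metis
    have small: "\<exists>N. absval u ^ N < e" if "e > 0" for e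
      using that u1 real_arch_pow_inv by blast
    have dec: "absval (\<theta> - \<iota> (a n)) < absval u ^ N" if "n \<ge> N" for n N
      using a[of n] power_decreasing[OF that, of "absval u"] u1 by linarith
    have "Cauchy a"
    proof (rule metric_CauchyI)
      fix e :: real assume "e > 0"
      then obtain N where N: "absval u ^ N < e"
        using small by blast
      have "dist (a m) (a n) < e" if "m \<ge> N" "n \<ge> N" for m n
      proof -
        have "absval ((\<theta> - \<iota> (a n)) - (\<theta> - \<iota> (a m))) < e"
          using dec[OF that(1)] dec[OF that(2)] N
          by (intro absval_diff_less[of "\<theta> - \<iota> (a n)"]) (blast intro: less_trans)+
        then have "absval (\<iota> (a m - a n)) < e"
          by (simp add: hom algebra_simps)
        then show ?thesis
          by (simp add: dist_absval iso)
      qed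
      then show "\<exists>M. \<forall>m\<ge>M. \<forall>n\<ge>M. dist (a m) (a n) < e"
        by blast
    qed
    then obtain l where l: "a \<longlonglongrightarrow> l"
      using Cauchy_convergent convergent_def by blast
    have "absval (\<theta> - \<iota> l) < e" if e: "e > 0" for e
    proof -
      obtain N where N: "absval u ^ N < e"
        using small[OF e] by blast
      obtain M where M: "\<And>n. n \<ge> M \<Longrightarrow> dist (a n) l < e"
        using metric_LIMSEQ_D[OF l \<open>e > 0\<close>] by blast
      define n where "n = max M N"
      have "absval ((\<theta> - \<iota> (a n)) + \<iota> (a n - l)) < e"
        using dec[of N n] N M[of n]
        by (intro absval_add_less) (auto simp: n_def iso dist_absval)
      then show ?thesis
        by (simp add: hom)
    qed
    from this[of "absval (\<theta> - \<iota> l)"] nz[of l] show False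
      by simp
  qed
  then obtain N :: nat where N: "\<And>a. absval u ^ N \<le> absval (\<theta> - \<iota> a)"
    by blast
  obtain k where k: "absval (\<theta> - \<iota> a) = absval u powi k a" for a
    using value_generator_powi[OF u nz] by metis
  have kN: "k a \<le> int N" for a
  proof (rule ccontr)
    assume "\<not> k a \<le> int N"
    then have "absval u powi k a < absval u powi int N"
      using u1 by (intro power_int_strict_decreasing) auto
    then show False
      using N[of a] k[of a] by simp
  qed
  \<comment> \<open>The exponents \<open>k a\<close> are bounded above by \<open>N\<close>; the
    largest one is found by minimizing the natural number \<open>N - k a\<close>, and it gives the
    smallest distance.\<close>
  define m where "m = (LEAST m. \<exists>a. m = nat (int N - k a))"
  obtain a where a: "m = nat (int N - k a)"
    using LeastI_ex[of "\<lambda>m. \<exists>a. m = nat (int N - k a)"] m_def by blast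
  have "k b \<le> k a" for b
  proof -
    have "m \<le> nat (int N - k b)"
      unfolding m_def by (rule Least_le) blast
    then show ?thesis
      using a kN[of a] kN[of b] by linarith
  qed
  then have min: "absval (\<theta> - \<iota> a) \<le> absval (\<theta> - \<iota> b)" for b
    unfolding k using u1 by (intro power_int_decreasing) auto
  obtain c :: 'f where c: "c \<noteq> 0" "absval c = absval (\<theta> - \<iota> a)"
  proof -
    have "absval (\<theta> - \<iota> a) \<in> absval ` (UNIV - {0 :: 'f})"
      unfolding vg[symmetric] using nz by blast
    then obtain c :: 'f where "absval (\<theta> - \<iota> a) = absval c" "c \<in> UNIV - {0}"
      by (rule imageE)
    then show thesis
      using that[of c] by simp
  qed
  have c0: "\<iota> c \<noteq> 0"
    using c iso[of c] by (metis absval_eq_0_iff)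
  show thesis
  proof (rule that[of "(\<theta> - \<iota> a) / \<iota> c"])
    show "absval ((\<theta> - \<iota> a) / \<iota> c) = 1"
      using c nz[of a] by (simp add: absval_divide iso)
    fix b
    have "(\<theta> - \<iota> a) / \<iota> c - \<iota> b = (\<theta> - \<iota> (a + b * c)) / \<iota> c"
      using c0 by (simp add: hom field_simps)
    then show "1 \<le> absval ((\<theta> - \<iota> a) / \<iota> c - \<iota> b)"
      using min[of "a + b * c"] c nz[of a] by (simp add: absval_divide iso le_divide_eq_1)
  qed
qed

text \<open>The ultrametric inequality settles unequal sizes. For equal sizes, factoring out
  \<open>\<iota> b\<close> leaves the distance from \<open>w\<close> to an element of F, which is at
  least 1.\<close>

lemma absval_max_decomposition:
  fixes \<iota> :: "'f::nonarch_local_field \<Rightarrow> 'e::nonarch_local_field"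
  assumes emb: "field_embedding \<iota>" and iso: "\<And>a. absval (\<iota> a) = absval a"
    and w: "absval w = 1" "\<And>a. absval (w - \<iota> a) \<ge> 1"
  shows "absval (\<iota> a + \<iota> b * w) = max (absval a) (absval b)"
proof -
  note hom = field_embedding_simps[OF emb]
  have bw: "absval (\<iota> b * w) = absval b"
    by (simp add: absval_mult iso w)
  consider "absval a < absval b" | "absval b < absval a" | "absval a = absval b"
    by linarith
  then show ?thesis
  proof cases
    case 1
    then show ?thesis
      using absval_add_eq_right[of "\<iota> a" "\<iota> b * w"] bw iso[of a] by simp
  next
    case 2
    then show ?thesis
      using absval_add_eq_left[of "\<iota> b * w" "\<iota> a"] bw iso[of a] by simp
  next
    case 3
    show ?thesis
    proof (cases "b = 0")
      case True
      then show ?thesis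
        by (simp add: hom iso)
    next
      case False
      then have "\<iota> b \<noteq> 0"
        using iso[of b] by (metis absval_eq_0_iff)
      then have "\<iota> a + \<iota> b * w = \<iota> b * (w - \<iota> (- a / b))"
        using False by (simp add: hom field_simps)
      then have "absval b \<le> absval (\<iota> a + \<iota> b * w)"
        using w(2)[of "- a / b"] mult_left_mono[of 1 "absval (w - \<iota> (- a / b))" "absval b"]
        by (simp add: absval_mult iso)
      moreover have "absval (\<iota> a + \<iota> b * w) \<le> absval b"
        using 3 bw iso by (intro absval_add_le) auto
      ultimately show ?thesis
        using 3 by simp
    qed
  qed
qed

lemma quadratic_decomposition:
  fixes \<iota> :: "'f::field \<Rightarrow> 'e::field"
  assumes emb: "field_embedding \<iota>" and deg: "extension_degree \<iota> = 2" and w: "w \<notin> range \<iota>"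
  shows "\<exists>a b. x = \<iota> a + \<iota> b * w"
proof -
  note hom = field_embedding_simps[OF emb]
  interpret V: vector_space "\<lambda>a x. \<iota> a * x"
    by unfold_locales (auto simp: hom algebra_simps)
  have dim: "V.dim UNIV = 2"
    using deg by (simp add: extension_degree_def)
  obtain B where B: "V.independent B" "V.span B = UNIV" "card B = 2"
    using V.basis_exists[of UNIV] dim by (metis UNIV_I subsetI subset_antisym)
  \<comment> \<open>An infinite set has \<open>card\<close> 0, so \<open>card B = 2\<close> also
    gives finiteness.\<close>
  then have fB: "finite B"
    by (metis card.infinite zero_neq_numeral)
  interpret V: finite_dimensional_vector_space "\<lambda>a x. \<iota> a * x" B
    by unfold_locales (use B fB in auto)
  have w1: "w \<noteq> 1" "w \<notin> V.span {1}"
    using w hom(2) by (auto simp: V.span_singleton)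
  then have ind: "V.independent {w, 1}"
    by (intro V.independent_insertI) (auto simp: V.span_empty V.independent_empty)
  have "UNIV \<subseteq> V.span {w, 1}"
    using ind w1 dim by (intro V.card_ge_dim_independent) auto
  then have "x \<in> V.span {w, 1}"
    by blast
  then obtain b where "x - \<iota> b * w \<in> V.span {1}"
    using V.span_insert[of w "{1}"] by auto
  then obtain a where "x - \<iota> b * w = \<iota> a"
    by (auto simp: V.span_singleton)
  then show ?thesis
    by (metis diff_eq_eq)
qed

lemma extension_degree_not_surj:
  fixes \<iota> :: "'f::field \<Rightarrow> 'e::field"
  assumes emb: "field_embedding \<iota>" and deg: "extension_degree \<iota> = 2"
  shows "\<exists>\<theta>. \<theta> \<notin> range \<iota>"
proof (rule ccontr)
  assume surj: "\<not> ?thesis"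
  note hom = field_embedding_simps[OF emb]
  interpret V: vector_space "\<lambda>a x. \<iota> a * x"
    by unfold_locales (auto simp: hom algebra_simps)
  have "UNIV \<subseteq> V.span {1}"
    using surj by (auto simp: V.span_singleton)
  then have "V.dim UNIV \<le> card {1 :: 'e}"
    by (intro V.dim_le_card) auto
  then show False
    using deg by (simp add: extension_degree_def)
qed

text \<open>Everything comes from the integral quadratic equation of \<open>w\<close>:
  \<open>\<sigma> w\<close> is its other root, which makes \<open>\<sigma>\<close> an involution and
  an isometry, and finiteness of the residue field keeps the two roots apart modulo the maximal
  ideal.\<close>

lemma exists_unramified_involution:
  fixes \<iota> :: "'f::nonarch_local_field \<Rightarrow> 'e::nonarch_local_field"
  assumes ur: "unramified_quadratic \<iota>" and gal: "\<sigma> \<in> galois_group \<iota>" "\<sigma> \<noteq> id"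
  obtains w p where "unramified_involution \<iota> \<sigma> w p"
proof -
  have emb: "field_embedding \<iota>" and iso: "\<And>a. absval (\<iota> a) = absval a"
    and unr: "unramified \<iota>" and deg: "extension_degree \<iota> = 2"
    and vg: "absval ` (UNIV - {0 :: 'e}) = absval ` (UNIV - {0 :: 'f})"
    using ur by (auto simp: unramified_quadratic_def unramified_def local_field_extension_def)
  have conj: "field_embedding \<sigma>" and fix_\<iota>: "\<And>a. \<sigma> (\<iota> a) = \<iota> a"
    using gal by (auto simp: galois_group_def)
  note hom = field_embedding_simps[OF emb] and chom = field_embedding_simps[OF conj]
  obtain \<theta> where "\<theta> \<notin> range \<iota>"
    using extension_degree_not_surj[OF emb deg] by blast
  then obtain w where w: "absval w = 1" "\<And>a. absval (w - \<iota> a) \<ge> 1"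
    using exists_residue_independent[OF unr] by metis
  note max_dec = absval_max_decomposition[OF emb iso w]
  have "w \<notin> range \<iota>"
  proof
    assume "w \<in> range \<iota>"
    then obtain a where "w = \<iota> a"
      by blast
    then show False
      using w(2)[of a] by simp
  qed
  note dec = quadratic_decomposition[OF emb deg this]
  obtain u :: 'e where u: "value_generator u"
    using absval_discrete unfolding value_generator_def by blast
  then have u1: "0 < absval u" "absval u < 1"
    by (auto simp: value_generator_def)
  \<comment> \<open>Equality of the value groups replaces the uniformizer of E by one from
    F.\<close>
  have "absval u \<in> absval ` (UNIV - {0 :: 'f})"
    unfolding vg[symmetric] using u1 by auto
  then obtain p :: 'f where p: "absval p = absval u"
    by (metis imageE)
  have gen: "value_generator (\<iota> p)" "value_generator p"
  proof -
    show "value_generator (\<iota> p)"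
      using u unfolding value_generator_def iso p .
    have "\<exists>k::int. absval x = absval u powi k" if "x \<noteq> 0" for x :: 'f
    proof -
      have "\<iota> x \<noteq> 0"
        using that field_embedding_eq_iff[OF emb, of x 0] hom(1) by simp
      then show ?thesis
        using value_generator_powi[OF u, of "\<iota> x"] iso by simp
    qed
    then show "value_generator p"
      using u1 unfolding value_generator_def p by blast
  qed
  obtain m s where ms: "w * w = \<iota> m + \<iota> s * w"
    using dec by blast
  have ms1: "absval m \<le> 1" "absval s \<le> 1"
    using max_dec[of m s] w(1) unfolding ms[symmetric] by (auto simp: absval_mult max_def split: if_splits)
  have cw_neq: "\<sigma> w \<noteq> w"
  proof
    assume *: "\<sigma> w = w"
    have "\<sigma> x = x" for x
      using dec[of x] * by (auto simp: chom fix_\<iota>)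
    then show False
      using gal(2) by auto
  qed
  \<comment> \<open>The difference of the quadratic equations of \<open>\<sigma> w\<close> and
    \<open>w\<close>; as \<open>\<sigma> w \<noteq> w\<close>, the second factor vanishes.\<close>
  have "(\<sigma> w - w) * (\<sigma> w + w - \<iota> s) = 0"
  proof -
    have "\<sigma> w * \<sigma> w = \<iota> m + \<iota> s * \<sigma> w"
      using arg_cong[OF ms, of \<sigma>] by (simp add: chom fix_\<iota>)
    then show ?thesis
      using ms by (simp add: algebra_simps)
  qed
  then have "\<sigma> w + w - \<iota> s = 0"
    using cw_neq by (metis mult_eq_0_iff right_minus_eq)
  then have cw: "\<sigma> w = \<iota> s - w"
    by (simp add: algebra_simps)
  have cc: "\<sigma> (\<sigma> x) = x" for x
    using dec[of x] by (auto simp: chom fix_\<iota> cw)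
  \<comment> \<open>The coordinates give only \<open>\<le>\<close>; applying this again to
    \<open>\<sigma> x\<close> gives equality.\<close>
  have cle: "absval (\<sigma> x) \<le> absval x" for x
  proof -
    obtain a b where x: "x = \<iota> a + \<iota> b * w"
      using dec by blast
    have "\<sigma> x = \<iota> a + \<iota> b * (\<iota> s - w)"
      by (simp add: x chom fix_\<iota> cw)
    moreover have "absval (\<iota> s - w) \<le> 1"
      using ms1 w iso by (intro absval_diff_le) auto
    moreover have "absval a \<le> absval x" "absval b \<le> absval x"
      by (auto simp: x max_dec)
    ultimately show ?thesis
      using iso by (auto intro!: absval_add_le absval_mult_le_right)
  qed
  have ciso: "absval (\<sigma> x) = absval x" for x
    using cle[of x] cle[of "\<sigma> x"] cc by simp
  have two: "\<iota> 2 = 2"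
    using hom(3)[of 1 1] hom(2) by simp
  \<comment> \<open>If \<open>w - \<sigma> w\<close> were not a unit, the quadratic equation of
    \<open>w\<close> would have a double root modulo the maximal ideal, and this root would come
    from F: \<open>s / 2\<close> if 2 is a unit, and otherwise a square root of \<open>m\<close>.
    Then \<open>w\<close> would be closer than 1 to F.\<close>
  have disc: "absval (w - \<sigma> w) = 1"
  proof (rule ccontr)
    assume "absval (w - \<sigma> w) \<noteq> 1"
    moreover have "absval (w - \<sigma> w) \<le> 1"
      using w ciso by (intro absval_diff_le) auto
    ultimately have d: "absval (2 * w - \<iota> s) < 1"
      by (simp add: cw algebra_simps)
    have abs2: "absval (2::'e) = absval (2::'f)" "absval (2::'f) \<le> 1"
      using iso[of 2] absval_add_le[of 1 1 "1::'f"] two by auto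
    show False
    proof (cases "absval (2::'f) = 1")
      case True
      then have "(2::'f) \<noteq> 0" "(2::'e) \<noteq> 0"
        using abs2 by auto
      then have "w - \<iota> (s / 2) = (2 * w - \<iota> s) / 2"
        by (simp add: hom two field_simps)
      then have "absval (w - \<iota> (s / 2)) = absval ((2 * w - \<iota> s) / 2)"
        by (rule arg_cong)
      then show False
        using w(2)[of "s / 2"] d True abs2 by (simp add: absval_divide)
    next
      case False
      then have small2: "absval (2::'f) < 1" "absval (2::'e) < 1"
        using abs2 by auto
      have "absval (2 * w - (2 * w - \<iota> s)) < 1"
        by (rule absval_diff_less[OF _ d]) (use small2 w in \<open>auto intro: absval_mult_less_right\<close>)
      then have s: "absval s < 1"
        by (simp add: iso)
      obtain R :: "'f set" where R: "residue_system R (absval p)"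
        using residue_system_1[OF gen(2)] by blast
      have p1: "absval p < 1"
        using gen(2) by (simp add: value_generator_def)
      have R1: "absval r \<le> 1" if "r \<in> R" for r
        using R that by (auto simp: residue_system_def)
      have Rep: "\<exists>r\<in>R. absval (x - r) \<le> absval p" if "absval x \<le> 1" for x
        using R that by (auto simp: residue_system_def)
      \<comment> \<open>\<open>f\<close> is the Frobenius map of the residue field: injective
        because \<open>(r - r') ^ 2\<close> agrees with \<open>r * r - r' * r'\<close> modulo 2,
        hence surjective, so \<open>m\<close> is a square modulo the maximal ideal.\<close>
      have "\<forall>r\<in>R. \<exists>s. s \<in> R \<and> absval (r * r - s) \<le> absval p"
        using Rep R1 absval_mult_le_left by blast
      then obtain f where "\<forall>r\<in>R. f r \<in> R \<and> absval (r * r - f r) \<le> absval p"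
        by (rule bchoice[THEN exE])
      then have f: "f r \<in> R" "absval (r * r - f r) \<le> absval p" if "r \<in> R" for r
        using that by auto
      have "inj_on f R"
      proof (rule inj_onI)
        fix r r' assume r: "r \<in> R" "r' \<in> R" "f r = f r'"
        have "absval (r * r - r' * r') < 1"
          using absval_diff_le[OF f(2)[OF r(1)] f(2)[OF r(2)]] p1 r(3) by simp
        moreover have "absval (2 * (r' * (r - r'))) < 1"
          using R1 r small2
          by (intro absval_mult_less_right absval_mult_le_left absval_diff_le) auto
        ultimately have "absval ((r * r - r' * r') - 2 * (r' * (r - r'))) < 1"
          by (rule absval_diff_less)
        then have "absval ((r - r') ^ 2) < 1"
          by (simp add: power2_eq_square algebra_simps)
        then have "absval (r - r') < 1"
          by (simp add: absval_power power_less_one_iff abs_square_less_1)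
        then have "absval (r - r') \<le> absval p"
          by (rule value_generator_less_1[OF gen(2)])
        then show "r = r'"
          using R r by (auto simp: residue_system_def)
      qed
      moreover have "finite R" "f ` R \<subseteq> R"
        using R f by (auto simp: residue_system_def)
      ultimately have surj: "f ` R = R"
        by (simp add: endo_inj_surj)
      obtain m0 where m0: "m0 \<in> R" "absval (m - m0) \<le> absval p"
        using Rep ms1 by blast
      have "m0 \<in> f ` R"
        using m0(1) by (simp only: surj)
      then obtain r where r: "r \<in> R" "f r = m0"
        by (metis imageE)
      have "absval ((m - m0) - (r * r - f r)) < 1"
        using absval_diff_le[OF m0(2) f(2)[OF r(1)]] p1 by linarith
      then have "absval (m - r * r) < 1"
        using r by simp
      moreover have "absval (\<iota> s * w) < 1"
        using s w by (intro absval_mult_less_right) (auto simp: iso)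
      moreover have "absval (2 * (\<iota> r * (\<iota> r - w))) < 1"
        using R1[OF r(1)] small2 w
        by (intro absval_mult_less_right absval_mult_le_left[of "\<iota> r" "\<iota> r - w" 1] absval_diff_le)
          (auto simp: iso)
      ultimately have "absval ((\<iota> s * w + \<iota> (m - r * r)) + 2 * (\<iota> r * (\<iota> r - w))) < 1"
        by (intro absval_add_less) (auto simp only: iso)
      \<comment> \<open>By the quadratic equation of \<open>w\<close>, the three small terms add up
        to a square.\<close>
      moreover have "(\<iota> s * w + \<iota> (m - r * r)) + 2 * (\<iota> r * (\<iota> r - w)) = (w - \<iota> r) ^ 2"
        using ms by (simp add: power2_eq_square hom algebra_simps)
      ultimately have "absval (w - \<iota> r) < 1"
        by (simp add: absval_power power_less_one_iff abs_square_less_1)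
      then show False
        using w(2)[of r] by simp
    qed
  qed
  have "unramified_involution \<iota> \<sigma> w p"
  proof
    show "\<exists>a. x = \<iota> a" if "\<sigma> x = x" for x
    proof -
      obtain a b where x: "x = \<iota> a + \<iota> b * w"
        using dec by blast
      have "\<iota> b * (w - \<sigma> w) = 0"
        using that by (auto simp: x chom fix_\<iota>)
      then have "\<iota> b = 0"
        using cw_neq by (metis mult_eq_0_iff right_minus_eq)
      then show ?thesis
        using x by auto
    qed
  qed (use emb iso conj ciso cc fix_\<iota> dec max_dec disc gen in auto)
  then show thesis
    by (rule that)
qed

section \<open>Topology of matrices over a valued field\<close>

lemma continuous_on_absval_add:
  fixes f g :: "'a::topological_space \<Rightarrow> 'b::complete_discretely_valued_field"
  assumes "continuous_on S f" and "continuous_on S g"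
  shows "continuous_on S (\<lambda>x. f x + g x)"
  unfolding continuous_on_def
proof (intro ballI tendstoI)
  fix x and e :: real assume "x \<in> S" "e > 0"
  then have "\<forall>\<^sub>F y in at x within S. dist (f y) (f x) < e" "\<forall>\<^sub>F y in at x within S. dist (g y) (g x) < e"
    using assms by (auto simp: continuous_on_def intro: tendstoD)
  then show "\<forall>\<^sub>F y in at x within S. dist (f y + g y) (f x + g x) < e"
  proof eventually_elim
    case (elim y)
    then show ?case
      using absval_add_less[of "f y - f x" e "g y - g x"] by (simp add: dist_absval algebra_simps)
  qed
qed

lemma continuous_on_absval_cmult:
  fixes f :: "'a::topological_space \<Rightarrow> 'b::complete_discretely_valued_field"
  assumes "continuous_on S f"
  shows "continuous_on S (\<lambda>x. c * f x)"
  unfolding continuous_on_def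
proof (intro ballI tendstoI)
  fix x and e :: real assume x: "x \<in> S" "e > 0"
  have c: "absval c + 1 > 0"
    using absval_nonneg[of c] by linarith
  then have "\<forall>\<^sub>F y in at x within S. dist (f y) (f x) < e / (absval c + 1)"
    using assms x by (auto simp: continuous_on_def intro: tendstoD)
  then show "\<forall>\<^sub>F y in at x within S. dist (c * f y) (c * f x) < e"
  proof eventually_elim
    case (elim y)
    have "dist (c * f y) (c * f x) = absval c * dist (f y) (f x)"
      by (simp add: dist_absval absval_mult right_diff_distrib[symmetric])
    also have "\<dots> \<le> (absval c + 1) * dist (f y) (f x)"
      by (simp add: mult_right_mono)
    also have "\<dots> < e"
      using elim c by (simp add: pos_less_divide_eq mult.commute)
    finally show ?case .
  qed
qed

lemma continuous_on_matrix_entry: "continuous_on S (\<lambda>g :: 'b::topological_space^'n^'m. g $ i $ j)"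
  by (intro continuous_intros)

lemma matrix_mult_3:
  fixes A B :: "'a::semiring_1^3^3"
  shows "(A ** B) $ i $ j = A $ i $ 1 * B $ 1 $ j + A $ i $ 2 * B $ 2 $ j + A $ i $ 3 * B $ 3 $ j"
  by (simp add: matrix_matrix_mult_def sum_3)

lemma matrix_3_eq_iff:
  fixes A B :: "'a^3^3"
  shows "A = B \<longleftrightarrow> A $ 1 $ 1 = B $ 1 $ 1 \<and> A $ 1 $ 2 = B $ 1 $ 2 \<and> A $ 1 $ 3 = B $ 1 $ 3 \<and>
    A $ 2 $ 1 = B $ 2 $ 1 \<and> A $ 2 $ 2 = B $ 2 $ 2 \<and> A $ 2 $ 3 = B $ 2 $ 3 \<and>
    A $ 3 $ 1 = B $ 3 $ 1 \<and> A $ 3 $ 2 = B $ 3 $ 2 \<and> A $ 3 $ 3 = B $ 3 $ 3"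
  by (auto simp: vec_eq_iff forall_3)

lemma mat_1_3 [simp]:
  "(mat 1 :: 'a::zero_neq_one^3^3) $ 1 $ 1 = 1" "(mat 1 :: 'a::zero_neq_one^3^3) $ 1 $ 2 = 0" "(mat 1 :: 'a::zero_neq_one^3^3) $ 1 $ 3 = 0"
  "(mat 1 :: 'a::zero_neq_one^3^3) $ 2 $ 1 = 0" "(mat 1 :: 'a::zero_neq_one^3^3) $ 2 $ 2 = 1" "(mat 1 :: 'a::zero_neq_one^3^3) $ 2 $ 3 = 0"
  "(mat 1 :: 'a::zero_neq_one^3^3) $ 3 $ 1 = 0" "(mat 1 :: 'a::zero_neq_one^3^3) $ 3 $ 2 = 0" "(mat 1 :: 'a::zero_neq_one^3^3) $ 3 $ 3 = 1"
  by (simp_all add: mat_def)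

text \<open>Makes translates of closed sets closed, hence cosets measurable.\<close>

lemma continuous_on_matrix_mult_left:
  fixes A :: "'b::complete_discretely_valued_field^3^3"
  shows "continuous_on S (\<lambda>g :: 'b^3^3. A ** g)"
proof -
  have *: "(\<lambda>g :: 'b^3^3. A ** g) = (\<lambda>g. \<chi> i j. A $ i $ 1 * g $ 1 $ j + A $ i $ 2 * g $ 2 $ j + A $ i $ 3 * g $ 3 $ j)"
    by (simp add: fun_eq_iff vec_eq_iff matrix_mult_3)
  show ?thesis
    unfolding *
    by (intro continuous_on_vec_lambda continuous_on_absval_add continuous_on_absval_cmult
        continuous_on_matrix_entry)
qed

lemma closed_matrix_entry_le:
  "closed {g :: 'b::complete_discretely_valued_field^3^3. absval (g $ i $ j - a) \<le> c}"
proof -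
  have "closed ((\<lambda>g :: 'b^3^3. g $ i $ j) -` cball a c)"
    by (intro continuous_closed_vimage closed_cball)
       (use continuous_on_matrix_entry[of UNIV] in \<open>simp add: continuous_on_eq_continuous_at\<close>)
  moreover have "(\<lambda>g :: 'b^3^3. g $ i $ j) -` cball a c = {g. absval (g $ i $ j - a) \<le> c}"
    by (auto simp: dist_absval absval_minus_commute)
  ultimately show ?thesis
    by simp
qed

section \<open>The unitary group\<close>

context unramified_involution
begin

lemmas hom = field_embedding_simps[OF embedding]
lemmas conj_simps = field_embedding_simps[OF conj_hom]

text \<open>The adjoint for the Hermitian form of \<open>antidiag_J\<close>: the conjugate matrix
  reflected in the antidiagonal. For unitary matrices it is the inverse. Spelling out the entries
  lets products be computed entry by entry.\<close>

definition adj :: "'e^3^3 \<Rightarrow> 'e^3^3" where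
  "adj g = vector [vector [\<sigma> (g $ 3 $ 3), \<sigma> (g $ 2 $ 3), \<sigma> (g $ 1 $ 3)],
                   vector [\<sigma> (g $ 3 $ 2), \<sigma> (g $ 2 $ 2), \<sigma> (g $ 1 $ 2)],
                   vector [\<sigma> (g $ 3 $ 1), \<sigma> (g $ 2 $ 1), \<sigma> (g $ 1 $ 1)]]"

lemma adj_entries [simp]:
  "adj g $ 1 $ 1 = \<sigma> (g $ 3 $ 3)" "adj g $ 1 $ 2 = \<sigma> (g $ 2 $ 3)" "adj g $ 1 $ 3 = \<sigma> (g $ 1 $ 3)"
  "adj g $ 2 $ 1 = \<sigma> (g $ 3 $ 2)" "adj g $ 2 $ 2 = \<sigma> (g $ 2 $ 2)" "adj g $ 2 $ 3 = \<sigma> (g $ 1 $ 2)"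
  "adj g $ 3 $ 1 = \<sigma> (g $ 3 $ 1)" "adj g $ 3 $ 2 = \<sigma> (g $ 2 $ 1)" "adj g $ 3 $ 3 = \<sigma> (g $ 1 $ 1)"
  by (simp_all add: adj_def)

abbreviation U where "U \<equiv> unitary_group \<sigma>"

lemma antidiag_J_mult_self: "antidiag_J ** antidiag_J = (mat 1 :: 'a::field^3^3)"
  by (simp add: matrix_3_eq_iff matrix_mult_3 antidiag_J_def)

lemma adj_eq: "adj g = antidiag_J ** transpose (map_matrix \<sigma> g) ** antidiag_J"
  by (simp add: matrix_3_eq_iff matrix_mult_3 antidiag_J_def transpose_def)

text \<open>\<open>antidiag_J\<close> is its own inverse, so it can be moved across the defining
  equation, and a one-sided inverse of a square matrix is two-sided.\<close>

lemma unitary_iff: "g \<in> U \<longleftrightarrow> adj g ** g = mat 1"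
proof -
  let ?X = "transpose (map_matrix \<sigma> g) ** antidiag_J ** g"
  have eq: "adj g ** g = antidiag_J ** ?X"
    by (simp add: adj_eq matrix_mul_assoc)
  have J: "antidiag_J ** (antidiag_J ** X) = X" for X :: "'e^3^3"
    by (simp add: matrix_mul_assoc antidiag_J_mult_self)
  have "adj g ** g = mat 1 \<longleftrightarrow> ?X = antidiag_J"
    unfolding eq by (metis J antidiag_J_mult_self)
  moreover have "invertible g" if "adj g ** g = mat 1"
    using that matrix_left_right_inverse[of "adj g" g] by (auto simp: invertible_def)
  ultimately show ?thesis
    by (auto simp: unitary_group_def)
qed

lemma adj_mult_self: "g \<in> U \<Longrightarrow> adj g ** g = mat 1"
  by (simp add: unitary_iff)

lemma mult_adj_self: "g \<in> U \<Longrightarrow> g ** adj g = mat 1"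
  using matrix_left_right_inverse[of "adj g" g] by (simp add: unitary_iff)

lemma adj_mult: "adj (g ** h) = adj h ** adj g"
  by (simp add: matrix_3_eq_iff matrix_mult_3 conj_simps mult.commute add.commute add.left_commute)

lemma adj_adj [simp]: "adj (adj g) = g"
  by (simp add: matrix_3_eq_iff)

lemma unitary_mult: "g \<in> U \<Longrightarrow> h \<in> U \<Longrightarrow> g ** h \<in> U"
proof -
  assume gh: "g \<in> U" "h \<in> U"
  have "adj (g ** h) ** (g ** h) = adj h ** (adj g ** g) ** h"
    by (simp add: adj_mult matrix_mul_assoc)
  then show ?thesis
    using gh by (simp add: unitary_iff)
qed

lemma unitary_adj: "g \<in> U \<Longrightarrow> adj g \<in> U"
  using mult_adj_self[of g] by (simp add: unitary_iff)

lemma mult_adj_cancel: "r \<in> U \<Longrightarrow> r ** (adj r ** g) = g"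
  by (simp add: matrix_mul_assoc mult_adj_self)

lemma adj_mult_cancel: "r \<in> U \<Longrightarrow> adj r ** (r ** g) = g"
  by (simp add: matrix_mul_assoc adj_mult_self)

text \<open>Values of the Hermitian form on columns: the outer columns are isotropic with product 1,
  and the middle one has norm 1 and is orthogonal to the first.\<close>

lemma unitary_relations:
  assumes "g \<in> U"
  shows "\<sigma> (g $ 3 $ 3) * g $ 1 $ 1 + \<sigma> (g $ 2 $ 3) * g $ 2 $ 1 + \<sigma> (g $ 1 $ 3) * g $ 3 $ 1 = 1"
    "\<sigma> (g $ 3 $ 3) * g $ 1 $ 3 + \<sigma> (g $ 2 $ 3) * g $ 2 $ 3 + \<sigma> (g $ 1 $ 3) * g $ 3 $ 3 = 0"
    "\<sigma> (g $ 3 $ 2) * g $ 1 $ 2 + \<sigma> (g $ 2 $ 2) * g $ 2 $ 2 + \<sigma> (g $ 1 $ 2) * g $ 3 $ 2 = 1"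
    "\<sigma> (g $ 3 $ 1) * g $ 1 $ 1 + \<sigma> (g $ 2 $ 1) * g $ 2 $ 1 + \<sigma> (g $ 1 $ 1) * g $ 3 $ 1 = 0"
    "\<sigma> (g $ 3 $ 1) * g $ 1 $ 2 + \<sigma> (g $ 2 $ 1) * g $ 2 $ 2 + \<sigma> (g $ 1 $ 1) * g $ 3 $ 2 = 0"
    "\<sigma> (g $ 3 $ 1) * g $ 1 $ 3 + \<sigma> (g $ 2 $ 1) * g $ 2 $ 3 + \<sigma> (g $ 1 $ 1) * g $ 3 $ 3 = 1"
  using adj_mult_self[OF assms] by (simp_all add: matrix_3_eq_iff matrix_mult_3)

lemma absval_det_unitary:
  assumes "g \<in> U"
  shows "absval (det g) = 1"
proof -
  have "det (adj g) = \<sigma> (det g)"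
    by (simp add: det_3 conj_simps algebra_simps)
  then have "\<sigma> (det g) * det g = 1"
    using adj_mult_self[OF assms] by (metis det_I det_mul)
  then have "absval (det g) * absval (det g) = 1"
    by (metis absval_mult absval_conj absval_1)
  then show ?thesis
    using absval_nonneg[of "det g"] by (metis abs_of_nonneg abs_square_eq_1 power2_eq_square)
qed

text \<open>\<open>G\<close> is the disjoint union of the translates of \<open>H\<close> by the
  \<open>r i\<close>, which all have the measure of \<open>H\<close> by left invariance. As
  \<open>H\<close> is cut out by a closed set, its translates are preimages of that set under
  inverse translations and therefore Borel in \<open>U\<close>.\<close>

lemma emeasure_cosets:
  assumes haar: "left_haar_measure U (**) M"
    and I: "finite I" and r: "\<And>i. i \<in> I \<Longrightarrow> r i \<in> U"
    and H: "H = U \<inter> C" and C: "closed C"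
    and quot: "\<And>g h. g \<in> H \<Longrightarrow> h \<in> H \<Longrightarrow> g ** adj h \<in> H"
    and G: "G \<subseteq> U" and sub: "\<And>i h. i \<in> I \<Longrightarrow> h \<in> H \<Longrightarrow> r i ** h \<in> G"
    and cover: "\<And>g. g \<in> G \<Longrightarrow> \<exists>i\<in>I. adj (r i) ** g \<in> H"
    and disj: "\<And>i j. i \<in> I \<Longrightarrow> j \<in> I \<Longrightarrow> adj (r i) ** r j \<in> H \<Longrightarrow> i = j"
  shows "emeasure M G = of_nat (card I) * emeasure M H"
proof -
  have sets: "sets M = sets (restrict_space borel U)"
    and inv: "\<And>g A. g \<in> U \<Longrightarrow> A \<in> sets M \<Longrightarrow> emeasure M ((**) g ` A) = emeasure M A"
    using haar by (auto simp: left_haar_measure_def)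
  have meas: "U \<inter> D \<in> sets M" if "closed D" for D
    using that by (auto simp: sets sets_restrict_space)
  have img: "(**) (r i) ` H = U \<inter> ((**) (adj (r i)) -` C)" if i: "i \<in> I" for i
  proof (intro set_eqI iffI)
    fix g assume "g \<in> (**) (r i) ` H"
    then show "g \<in> U \<inter> ((**) (adj (r i)) -` C)"
      using r[OF i] by (auto simp: H unitary_mult adj_mult_cancel)
  next
    fix g assume "g \<in> U \<inter> ((**) (adj (r i)) -` C)"
    then show "g \<in> (**) (r i) ` H"
      using r[OF i]
      by (intro image_eqI[of _ _ "adj (r i) ** g"]) (auto simp: H mult_adj_cancel unitary_mult unitary_adj)
  qed
  have "closed ((**) (adj (r i)) -` C)" for i
    using continuous_on_matrix_mult_left[of UNIV "adj (r i)"] C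
    by (intro continuous_closed_vimage) (auto simp: continuous_on_eq_continuous_at)
  then have imeas: "(**) (r i) ` H \<in> sets M" if "i \<in> I" for i
    using meas img[OF that] by simp
  have "G = (\<Union>i\<in>I. (**) (r i) ` H)"
  proof (intro set_eqI iffI)
    fix g assume "g \<in> G"
    then obtain i where i: "i \<in> I" "adj (r i) ** g \<in> H"
      using cover by blast
    then show "g \<in> (\<Union>i\<in>I. (**) (r i) ` H)"
      using r mult_adj_cancel by (metis UN_I image_eqI)
  qed (use sub in auto)
  moreover have "disjoint_family_on (\<lambda>i. (**) (r i) ` H) I"
    unfolding disjoint_family_on_def
  proof (intro ballI impI, rule ccontr)
    fix i j assume ij: "i \<in> I" "j \<in> I" "i \<noteq> j" "(**) (r i) ` H \<inter> (**) (r j) ` H \<noteq> {}"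
    then obtain h k where hk: "h \<in> H" "k \<in> H" "r i ** h = r j ** k"
      by blast
    have "adj (r i) ** r j = adj (r i) ** (r j ** k) ** adj k"
      using hk by (simp add: H matrix_mul_assoc[symmetric] mult_adj_self)
    also have "\<dots> = h ** adj k"
      using hk(3)[symmetric] r[OF ij(1)] by (simp add: adj_mult_cancel)
    finally show False
      using quot[OF hk(1,2)] disj[OF ij(1,2)] ij(3) by simp
  qed
  ultimately have "emeasure M G = (\<Sum>i\<in>I. emeasure M ((**) (r i) ` H))"
    using I imeas by (subst sum_emeasure) auto
  also have "\<dots> = (\<Sum>i\<in>I. emeasure M H)"
    using r inv meas[OF C] by (intro sum.cong) (auto simp: H)
  finally show ?thesis
    by simp
qed


section \<open>Miyauchi subgroups and their common subgroups\<close>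

text \<open>Congruences modulo the \<open>n\<close>-th power of the maximal ideal are bounds by \<open>c = absval p ^ n\<close>.\<close>

definition integral_unitary :: "('e^3^3) set" where
  "integral_unitary = {g \<in> U. \<forall>i j. absval (g $ i $ j) \<le> 1}"

text \<open>For \<open>c = absval p ^ n\<close> this is K_n, \<open>parahoric1 c\<close> is H_n and
  \<open>miyauchi c\<close> is Gamma_n; \<open>integral_unitary\<close> is Gamma_0.\<close>

definition parahoric :: "real \<Rightarrow> ('e^3^3) set" where
  "parahoric c = {g \<in> integral_unitary.
     absval (g $ 2 $ 1) \<le> c \<and> absval (g $ 3 $ 1) \<le> c \<and> absval (g $ 3 $ 2) \<le> c}"

definition parahoric1 :: "real \<Rightarrow> ('e^3^3) set" where
  "parahoric1 c = {g \<in> parahoric c. absval (g $ 2 $ 2 - 1) \<le> c}"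

definition miyauchi :: "real \<Rightarrow> ('e^3^3) set" where
  "miyauchi c = {g \<in> U.
     absval (g $ 1 $ 1) \<le> 1 \<and> absval (g $ 1 $ 2) \<le> 1 \<and> absval (g $ 1 $ 3) \<le> inverse c \<and>
     absval (g $ 2 $ 1) \<le> c \<and> absval (g $ 2 $ 2 - 1) \<le> c \<and> absval (g $ 2 $ 3) \<le> 1 \<and>
     absval (g $ 3 $ 1) \<le> c \<and> absval (g $ 3 $ 2) \<le> c \<and> absval (g $ 3 $ 3) \<le> 1}"

lemma integral_unitary_iff:
  "g \<in> integral_unitary \<longleftrightarrow> g \<in> U \<and>
     absval (g $ 1 $ 1) \<le> 1 \<and> absval (g $ 1 $ 2) \<le> 1 \<and> absval (g $ 1 $ 3) \<le> 1 \<and>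
     absval (g $ 2 $ 1) \<le> 1 \<and> absval (g $ 2 $ 2) \<le> 1 \<and> absval (g $ 2 $ 3) \<le> 1 \<and>
     absval (g $ 3 $ 1) \<le> 1 \<and> absval (g $ 3 $ 2) \<le> 1 \<and> absval (g $ 3 $ 3) \<le> 1"
  by (auto simp: integral_unitary_def forall_3)

lemma integral_unitary_mult:
  assumes "g \<in> integral_unitary" "h \<in> integral_unitary"
  shows "g ** h \<in> integral_unitary"
  using assms unfolding integral_unitary_def
  by (auto simp: unitary_mult matrix_mult_3 intro!: absval_add_le intro: absval_mult_le_left)

lemma integral_unitary_adj: "g \<in> integral_unitary \<Longrightarrow> adj g \<in> integral_unitary"
  by (simp add: integral_unitary_iff unitary_adj)

lemma parahoric_mult:
  assumes "g \<in> parahoric c" "h \<in> parahoric c"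
  shows "g ** h \<in> parahoric c"
  using assms integral_unitary_mult[of g h] unfolding parahoric_def
  by (auto simp: integral_unitary_iff matrix_mult_3 intro!: absval_add_le
      intro: absval_mult_le_left absval_mult_le_right)

lemma parahoric_adj: "g \<in> parahoric c \<Longrightarrow> adj g \<in> parahoric c"
  by (simp add: parahoric_def integral_unitary_adj)

lemma parahoric1_mult:
  assumes "g \<in> parahoric1 c" "h \<in> parahoric1 c"
  shows "g ** h \<in> parahoric1 c"
proof -
  have gh: "g \<in> parahoric c" "h \<in> parahoric c" and
    b: "absval (g $ 2 $ 1) \<le> c" "absval (h $ 1 $ 2) \<le> 1" "absval (g $ 2 $ 2 - 1) \<le> c"
    "absval (h $ 2 $ 2) \<le> 1" "absval (h $ 2 $ 2 - 1) \<le> c" "absval (g $ 2 $ 3) \<le> 1" "absval (h $ 3 $ 2) \<le> c"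
    using assms by (auto simp: parahoric1_def parahoric_def integral_unitary_iff)
  \<comment> \<open>The middle summand is \<open>g $ 2 $ 2 * h $ 2 $ 2 - 1\<close>, split so that
    each factor contributes its own distance from 1.\<close>
  have "absval (g $ 2 $ 1 * h $ 1 $ 2 + ((g $ 2 $ 2 - 1) * h $ 2 $ 2 + (h $ 2 $ 2 - 1)) + g $ 2 $ 3 * h $ 3 $ 2) \<le> c"
    by (intro absval_add_le absval_mult_le_left[OF b(6,7)] absval_mult_le_right[OF b(1,2)]
        absval_mult_le_right[OF b(3,4)] b(5))
  then have "absval ((g ** h) $ 2 $ 2 - 1) \<le> c"
    by (simp add: matrix_mult_3 algebra_simps)
  then show ?thesis
    using parahoric_mult[OF gh] by (simp add: parahoric1_def)
qed

lemma parahoric1_adj: "g \<in> parahoric1 c \<Longrightarrow> adj g \<in> parahoric1 c"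
  using absval_conj[of "g $ 2 $ 2 - 1"] by (simp add: parahoric1_def parahoric_adj conj_simps)

lemma parahoric_closed: "\<exists>C. closed C \<and> parahoric c = U \<inter> C"
proof (intro exI conjI)
  let ?B = "\<lambda>i j c. {g :: 'e^3^3. absval (g $ i $ j - 0) \<le> c}"
  let ?C = "(\<Inter>i. \<Inter>j. ?B i j 1) \<inter> ?B 2 1 c \<inter> ?B 3 1 c \<inter> ?B 3 2 c"
  show "closed ?C"
    by (intro closed_Int closed_INT ballI closed_matrix_entry_le)
  show "parahoric c = U \<inter> ?C"
    by (auto simp: parahoric_def integral_unitary_def)
qed

lemma parahoric1_closed: "\<exists>C. closed C \<and> parahoric1 c = U \<inter> C"
proof -
  obtain C where C: "closed C" "parahoric c = U \<inter> C"
    using parahoric_closed by blast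
  then have "parahoric1 c = U \<inter> (C \<inter> {g. absval (g $ 2 $ 2 - 1) \<le> c})"
    by (auto simp: parahoric1_def)
  moreover have "closed (C \<inter> {g. absval (g $ 2 $ 2 - 1) \<le> c})"
    by (intro closed_Int C closed_matrix_entry_le)
  ultimately show ?thesis
    by auto
qed

text \<open>Otherwise every term in the product of the first and third columns would be below 1, but
  their sum is 1.\<close>

lemma parahoric_unit:
  assumes "g \<in> parahoric c" "c < 1"
  shows "absval (g $ 1 $ 1) = 1"
proof (rule ccontr)
  assume "absval (g $ 1 $ 1) \<noteq> 1"
  with assms have "absval (\<sigma> (g $ 3 $ 3) * g $ 1 $ 1 + \<sigma> (g $ 2 $ 3) * g $ 2 $ 1 + \<sigma> (g $ 1 $ 3) * g $ 3 $ 1) < 1"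
    by (intro absval_add_less absval_mult_less_left) (auto simp: parahoric_def integral_unitary_iff)
  then show False
    using unitary_relations(1)[of g] assms by (simp add: parahoric_def integral_unitary_def)
qed

text \<open>Membership is decided by the first column, because its orthogonality to the second one
  bounds the (3,2) entry.\<close>

lemma parahoric_intro:
  assumes g: "g \<in> integral_unitary" and c: "absval (g $ 1 $ 1) = 1"
    "absval (g $ 2 $ 1) \<le> c" "absval (g $ 3 $ 1) \<le> c"
  shows "g \<in> parahoric c"
proof -
  have "absval (\<sigma> (g $ 3 $ 1) * g $ 1 $ 2 + \<sigma> (g $ 2 $ 1) * g $ 2 $ 2) \<le> c"
    using g c by (intro absval_add_le absval_mult_le_right) (auto simp: integral_unitary_iff)
  moreover have "\<sigma> (g $ 3 $ 1) * g $ 1 $ 2 + \<sigma> (g $ 2 $ 1) * g $ 2 $ 2 = - (\<sigma> (g $ 1 $ 1) * g $ 3 $ 2)"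
    using unitary_relations(5)[of g] g by (simp add: integral_unitary_def eq_neg_iff_add_eq_0)
  ultimately have "absval (g $ 3 $ 2) \<le> c"
    using c by (simp add: absval_mult)
  then show ?thesis
    using g c by (simp add: parahoric_def)
qed

section \<open>Cosets in the maximal compact subgroup\<close>

definition d :: 'e where "d = w - \<sigma> w"

lemma absval_w [simp]: "absval w = 1"
  using absval_decomposition[of 0 1] by (simp add: hom)

lemma absval_d [simp]: "absval d = 1"
  using absval_discriminant by (simp add: d_def)

lemma d_nonzero [simp]: "d \<noteq> 0"
  using absval_d by fastforce

lemma conj_d [simp]: "\<sigma> d = - d"
  by (simp add: d_def conj_simps)

text \<open>
  As \<open>w / d\<close> has trace 1 and \<open>d\<close> has trace 0, the pairs \<open>(par_x a b, par_y a b t)\<close> are the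
  solutions of \<open>y + \<sigma> y + x * \<sigma> x = 0\<close>.
\<close>

definition par_x :: "'f \<Rightarrow> 'f \<Rightarrow> 'e" where
  "par_x a b = \<iota> a + \<iota> b * w"

definition par_y :: "'f \<Rightarrow> 'f \<Rightarrow> 'f \<Rightarrow> 'e" where
  "par_y a b t = - (w / d) * (par_x a b * \<sigma> (par_x a b)) + d * \<iota> t"

lemma par_isotropic:
  "par_y a b t + \<sigma> (par_y a b t) + par_x a b * \<sigma> (par_x a b) = 0"
proof -
  have "w / d + \<sigma> w / \<sigma> d = 1"
    by (simp add: d_def[symmetric] diff_divide_distrib[symmetric])
  then have "(w / d + \<sigma> w / \<sigma> d) * (par_x a b * \<sigma> (par_x a b)) = par_x a b * \<sigma> (par_x a b)"
    by simp
  then show ?thesis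
    by (simp add: par_y_def conj_simps algebra_simps)
qed

lemma absval_par_x_diff:
  "absval (par_x a b - par_x a' b') \<le> c \<longleftrightarrow> absval (a - a') \<le> c \<and> absval (b - b') \<le> c"
proof -
  have "par_x a b - par_x a' b' = \<iota> (a - a') + \<iota> (b - b') * w"
    by (simp add: par_x_def hom algebra_simps)
  then show ?thesis
    by (simp add: absval_decomposition)
qed

text \<open>The norms of close \<open>par_x\<close> differ by at most \<open>c\<close>, and
  \<open>d\<close> is a unit, so the distance of the \<open>par_y\<close> is governed by
  \<open>t - t'\<close>.\<close>

lemma par_close:
  assumes "absval (par_x a b) \<le> 1" "absval (par_x a' b') \<le> 1"
    and x: "absval (par_x a b - par_x a' b') \<le> c"
  shows "absval (par_y a b t - par_y a' b' t') \<le> c \<longleftrightarrow> absval (t - t') \<le> c"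
proof -
  let ?x = "par_x a b" and ?x' = "par_x a' b'"
  define e where "e = (w / d) * ((?x - ?x') * \<sigma> ?x + ?x' * \<sigma> (?x - ?x'))"
  have e: "absval e \<le> c"
    using assms unfolding e_def
    by (intro absval_mult_le_left[of "w / d"] absval_add_le absval_mult_le_right[of "?x - ?x'"]
        absval_mult_le_left[of ?x']) (simp_all add: absval_divide)
  have eq: "par_y a b t - par_y a' b' t' = d * \<iota> (t - t') - e"
    by (simp add: par_y_def e_def hom conj_simps algebra_simps)
  have dt: "absval (d * \<iota> (t - t')) = absval (t - t')"
    by (simp add: absval_mult)
  show ?thesis
  proof
    assume "absval (par_y a b t - par_y a' b' t') \<le> c"
    from absval_add_le[OF this e] show "absval (t - t') \<le> c"
      unfolding eq by (simp add: dt)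
  next
    assume "absval (t - t') \<le> c"
    then show "absval (par_y a b t - par_y a' b' t') \<le> c"
      unfolding eq by (intro absval_diff_le e) (simp add: dt)
  qed
qed

lemma par_0 [simp]: "par_x 0 0 = 0" "par_y 0 0 0 = 0"
  by (simp_all add: par_x_def par_y_def hom)

lemma par_le:
  assumes "absval a \<le> c" "absval b \<le> c" "absval t \<le> c" "c \<le> 1"
  shows "absval (par_x a b) \<le> c" "absval (par_y a b t) \<le> c"
proof -
  show x: "absval (par_x a b) \<le> c"
    using absval_par_x_diff[of a b 0 0] assms by simp
  show "absval (par_y a b t) \<le> c"
    using par_close[of a b 0 0 c t 0] x assms by simp
qed

text \<open>\<open>par_y a b 0\<close> has the same trace as \<open>y\<close>, so the difference has
  trace 0; divided by \<open>d\<close> it is fixed by \<open>\<sigma>\<close> and comes from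
  F.\<close>

lemma exists_par:
  assumes iso: "y + \<sigma> y + x * \<sigma> x = 0" and x: "absval x \<le> 1"
  obtains a b t where "x = par_x a b" "y = par_y a b t"
proof -
  obtain a b where ab: "x = par_x a b"
    using decomposition[of x] by (auto simp: par_x_def)
  have "\<sigma> ((y - par_y a b 0) / d) = (y - par_y a b 0) / d"
  proof -
    have "y + \<sigma> y = par_y a b 0 + \<sigma> (par_y a b 0)"
      using iso par_isotropic[of a b 0] unfolding ab by (metis add_right_cancel)
    then have "\<sigma> y - \<sigma> (par_y a b 0) = - (y - par_y a b 0)"
      by (simp add: algebra_simps)
    then show ?thesis
      by (simp add: conj_simps minus_divide_left)
  qed
  then obtain t where "(y - par_y a b 0) / d = \<iota> t"
    using fixed_point by blast
  then have "y = par_y a b t"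
    by (simp add: par_y_def hom field_simps)
  then show thesis
    using that ab by blast
qed

lemma par_bounds:
  assumes "absval (par_x a b) \<le> c" "absval (par_y a b t) \<le> c" "c \<le> 1"
  shows "absval a \<le> c" "absval b \<le> c" "absval t \<le> c"
  using assms absval_par_x_diff[of a b 0 0 c] par_close[of a b 0 0 c t 0] by auto

section \<open>Lower unipotent matrices and the index of K_n in Gamma_0\<close>

definition nminus :: "'e \<Rightarrow> 'e \<Rightarrow> 'e^3^3" where
  "nminus x y = vector [vector [1, 0, 0], vector [x, 1, 0], vector [y, - \<sigma> x, 1]]"

lemma nminus_entries [simp]:
  "nminus x y $ 1 $ 1 = 1" "nminus x y $ 1 $ 2 = 0" "nminus x y $ 1 $ 3 = 0"
  "nminus x y $ 2 $ 1 = x" "nminus x y $ 2 $ 2 = 1" "nminus x y $ 2 $ 3 = 0"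
  "nminus x y $ 3 $ 1 = y" "nminus x y $ 3 $ 2 = - \<sigma> x" "nminus x y $ 3 $ 3 = 1"
  by (simp_all add: nminus_def)

lemma antidiag_J_entries [simp]:
  "(antidiag_J :: 'a::field^3^3) $ 1 $ 1 = 0" "(antidiag_J :: 'a^3^3) $ 1 $ 2 = 0" "(antidiag_J :: 'a^3^3) $ 1 $ 3 = 1"
  "(antidiag_J :: 'a^3^3) $ 2 $ 1 = 0" "(antidiag_J :: 'a^3^3) $ 2 $ 2 = 1" "(antidiag_J :: 'a^3^3) $ 2 $ 3 = 0"
  "(antidiag_J :: 'a^3^3) $ 3 $ 1 = 1" "(antidiag_J :: 'a^3^3) $ 3 $ 2 = 0" "(antidiag_J :: 'a^3^3) $ 3 $ 3 = 0"
  by (simp_all add: antidiag_J_def)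

text \<open>The hypothesis makes the first column isotropic; the entry \<open>- \<sigma> x\<close>
  makes the second column orthogonal to it.\<close>

lemma nminus_unitary:
  assumes "y + \<sigma> y + x * \<sigma> x = 0"
  shows "nminus x y \<in> U"
  using assms by (simp add: unitary_iff matrix_3_eq_iff matrix_mult_3 conj_simps algebra_simps)

lemma adj_antidiag_J: "adj antidiag_J = antidiag_J"
  by (simp add: matrix_3_eq_iff conj_simps)

lemma antidiag_J_integral_unitary: "antidiag_J \<in> integral_unitary"
  by (simp add: integral_unitary_iff unitary_iff adj_antidiag_J antidiag_J_mult_self)

abbreviation npar :: "'f \<times> 'f \<times> 'f \<Rightarrow> 'e^3^3" where
  "npar \<equiv> \<lambda>(a, b, t). nminus (par_x a b) (par_y a b t)"

lemma npar_integral_unitary: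
  assumes "absval a \<le> 1" "absval b \<le> 1" "absval t \<le> 1"
  shows "npar (a, b, t) \<in> integral_unitary"
  using par_le[of a 1 b t] assms nminus_unitary[OF par_isotropic]
  by (simp add: integral_unitary_iff)

text \<open>The coset representative is found by scaling the first column of \<open>g\<close> to have leading entry 1.\<close>

lemma npar_cover:
  fixes S :: "'f set"
  assumes g: "g \<in> integral_unitary" and u: "absval (g $ 1 $ 1) = 1"
    and S: "residue_system S c" and c: "0 < c" "c < 1"
  obtains a b t where "a \<in> S" "b \<in> S" "t \<in> S" "adj (npar (a, b, t)) ** g \<in> parahoric c"
    "absval (g $ 2 $ 1) < 1 \<Longrightarrow> absval (g $ 3 $ 1) < 1 \<Longrightarrow> absval a < 1 \<and> absval b < 1 \<and> absval t < 1"
proof -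
  let ?u = "g $ 1 $ 1"
  have u0: "?u \<noteq> 0" "\<sigma> ?u \<noteq> 0"
    using u absval_conj[of ?u] by (metis absval_0 zero_neq_one)+
  define x y where "x = g $ 2 $ 1 / ?u" and "y = g $ 3 $ 1 / ?u"
  have gx: "g $ 2 $ 1 = x * ?u" "g $ 3 $ 1 = y * ?u"
    using u0 by (simp_all add: x_def y_def)
  have axy: "absval x = absval (g $ 2 $ 1)" "absval y = absval (g $ 3 $ 1)"
    using u by (simp_all add: gx absval_mult)
  then have xy1: "absval x \<le> 1" "absval y \<le> 1"
    using g by (auto simp: integral_unitary_iff)
  have "\<sigma> ?u * ?u * (y + \<sigma> y + x * \<sigma> x) = 0"
    using unitary_relations(4)[of g] g by (simp add: integral_unitary_def gx conj_simps algebra_simps)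
  then have iso: "y + \<sigma> y + x * \<sigma> x = 0"
    using u0 by simp
  obtain a b t where abt: "x = par_x a b" "y = par_y a b t"
    using exists_par[OF iso xy1(1)] by blast
  have bd: "absval a \<le> 1" "absval b \<le> 1" "absval t \<le> 1"
    using par_bounds[of a b 1 t] xy1 abt by auto
  have "\<exists>s\<in>S. absval (r - s) \<le> c" if "absval r \<le> 1" for r
    using S that by (auto simp: residue_system_def)
  then obtain a' b' t' where S': "a' \<in> S" "b' \<in> S" "t' \<in> S"
    and close: "absval (a - a') \<le> c" "absval (b - b') \<le> c" "absval (t - t') \<le> c"
    using bd by metis
  have bd': "absval a' \<le> 1" "absval b' \<le> 1" "absval t' \<le> 1"
    using S S' by (auto simp: residue_system_def)
  let ?x = "par_x a' b'" and ?y = "par_y a' b' t'"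
  have xy1': "absval ?x \<le> 1" "absval ?y \<le> 1"
    using par_le[of a' 1 b' t'] bd' by auto
  have cx: "absval (x - ?x) \<le> c"
    using close by (simp add: abt absval_par_x_diff)
  have cy: "absval (y - ?y) \<le> c"
    using par_close[of a b a' b' c t t'] close cx xy1 xy1' abt by simp
  let ?h = "adj (npar (a', b', t')) ** g"
  have h: "?h \<in> integral_unitary"
    using g bd' by (intro integral_unitary_mult integral_unitary_adj npar_integral_unitary)
  have h11: "?h $ 1 $ 1 = ?u"
    by (simp add: matrix_mult_3 conj_simps)
  have h21: "?h $ 2 $ 1 = (x - ?x) * ?u"
    by (simp add: matrix_mult_3 gx conj_simps algebra_simps)
  have "?h $ 3 $ 1 = (\<sigma> ?y + \<sigma> ?x * x + y) * ?u"
    by (simp add: matrix_mult_3 gx conj_simps algebra_simps)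
  \<comment> \<open>Isotropy of the representative eliminates \<open>\<sigma> ?y\<close>, leaving
    only differences.\<close>
  also have "\<sigma> ?y + \<sigma> ?x * x + y = (y - ?y) + \<sigma> ?x * (x - ?x)"
    using par_isotropic[of a' b' t'] by (simp add: algebra_simps)
  finally have h31: "?h $ 3 $ 1 = ((y - ?y) + \<sigma> ?x * (x - ?x)) * ?u" .
  have "?h \<in> parahoric c"
  proof (rule parahoric_intro[OF h])
    show "absval (?h $ 3 $ 1) \<le> c"
      unfolding h31 using cx cy u xy1'
      by (intro absval_mult_le_right absval_add_le absval_mult_le_left[of "\<sigma> ?x"]) auto
  qed (use cx u h11 h21 in \<open>simp_all add: absval_mult\<close>)
  moreover have "absval s' < 1" if "absval s < 1" "absval (s - s') \<le> c" for s s' :: 'f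
    using absval_diff_less[of s 1 "s - s'"] that c by simp
  \<comment> \<open>\<open>par_bounds\<close> takes a non-strict bound; the larger of the two values
    serves and is still below 1.\<close>
  moreover have "absval a < 1 \<and> absval b < 1 \<and> absval t < 1" if "absval x < 1" "absval y < 1"
  proof -
    have "absval x \<le> max (absval x) (absval y)" "absval y \<le> max (absval x) (absval y)"
      "max (absval x) (absval y) < 1"
      using that by auto
    then show ?thesis
      using par_bounds[of a b "max (absval x) (absval y)" t] abt by auto
  qed
  ultimately show thesis
    using that[OF S', folded axy] close axy by metis
qed

text \<open>If the leading entry of the first column is a unit, a lower unipotent representative
  fits. If not, isotropy makes the middle entry a non-unit, the product with the third column then
  makes the last entry a unit, and \<open>antidiag_J\<close> swaps the outer two. The other entries
  are non-units, so the parameters can be taken from the maximal ideal.\<close>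

lemma emeasure_integral_unitary:
  fixes S :: "'f set"
  assumes haar: "left_haar_measure U (**) M"
    and S: "residue_system S c" and c: "0 < c" "c < 1"
  shows "emeasure M integral_unitary =
    of_nat (card S ^ 3 + card {s \<in> S. absval s < 1} ^ 3) * emeasure M (parahoric c)"
proof -
  define S1 where "S1 = {s \<in> S. absval s < 1}"
  have S_le: "absval s \<le> 1" if "s \<in> S" for s
    using S that by (auto simp: residue_system_def)
  have finS: "finite S" "finite S1"
    using S by (auto simp: residue_system_def S1_def)
  define I where "I = (S \<times> S \<times> S) <+> (S1 \<times> S1 \<times> S1)"
  define r where "r = case_sum npar (\<lambda>i. antidiag_J ** npar i)"
  have npar: "npar i \<in> integral_unitary" if "i \<in> S \<times> S \<times> S" for i
    using that npar_integral_unitary S_le by auto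
  have S1_S: "s \<in> S" if "s \<in> S1" for s
    using that by (simp add: S1_def)
  have S1S: "S1 \<times> S1 \<times> S1 \<subseteq> S \<times> S \<times> S"
    by (auto simp: S1_def)
  have rint: "r i \<in> integral_unitary" if "i \<in> I" for i
    using that npar S1_S antidiag_J_integral_unitary
    by (auto simp: I_def r_def simp del: case_prod_conv intro!: integral_unitary_mult)
  have disj_npar: "i = j" if "i \<in> S \<times> S \<times> S" "j \<in> S \<times> S \<times> S" "adj (npar i) ** npar j \<in> parahoric c" for i j
  proof -
    obtain a b t a' b' t' where ij: "i = (a, b, t)" "j = (a', b', t')"
      by (metis prod_cases3)
    let ?x = "par_x a b" and ?y = "par_y a b t" and ?x' = "par_x a' b'" and ?y' = "par_y a' b' t'"
    have "absval a \<le> 1" "absval b \<le> 1" "absval t \<le> 1" "absval a' \<le> 1" "absval b' \<le> 1" "absval t' \<le> 1"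
      using that S_le by (auto simp: ij)
    then have b: "absval ?x \<le> 1" "absval ?x' \<le> 1"
      using par_le[of a 1 b t] par_le[of a' 1 b' t'] by auto
    have "absval ((adj (npar i) ** npar j) $ 2 $ 1) \<le> c" and e31: "absval ((adj (npar i) ** npar j) $ 3 $ 1) \<le> c"
      using that(3) by (auto simp: parahoric_def)
    then have cx: "absval (?x' - ?x) \<le> c"
      by (simp add: ij matrix_mult_3 conj_simps)
    have "(adj (npar i) ** npar j) $ 3 $ 1 = (?y' - ?y) + \<sigma> ?x * (?x' - ?x)"
      using par_isotropic[of a b t] by (simp add: ij matrix_mult_3 conj_simps algebra_simps)
    with e31 have "absval (((?y' - ?y) + \<sigma> ?x * (?x' - ?x)) - \<sigma> ?x * (?x' - ?x)) \<le> c"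
      using b cx by (intro absval_diff_le[of "_ + _"] absval_mult_le_left[of "\<sigma> ?x"]) simp_all
    then have "absval (?y' - ?y) \<le> c"
      by simp
    then have "absval (a' - a) \<le> c" "absval (b' - b) \<le> c" "absval (t' - t) \<le> c"
      using par_close[OF b(2,1) cx] cx by (auto simp: absval_par_x_diff)
    then show ?thesis
      using S that by (auto simp: ij residue_system_def)
  qed
  \<comment> \<open>The leading entry of this product is \<open>par_y\<close> of the small
    parameters \<open>j\<close>, hence not a unit, contrary to
    \<open>parahoric_unit\<close>.\<close>
  have mixed: "adj (npar i) ** (antidiag_J ** npar j) \<notin> parahoric c"
    if "i \<in> S \<times> S \<times> S" "j \<in> S1 \<times> S1 \<times> S1" for i j
  proof
    assume "adj (npar i) ** (antidiag_J ** npar j) \<in> parahoric c"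
    then have unit: "absval ((adj (npar i) ** (antidiag_J ** npar j)) $ 1 $ 1) = 1"
      by (rule parahoric_unit[OF _ c(2)])
    obtain a b t a' b' t' where ij: "i = (a, b, t)" "j = (a', b', t')"
      by (metis prod_cases3)
    define m where "m = Max {absval a', absval b', absval t'}"
    have "m < 1" "absval a' \<le> m" "absval b' \<le> m" "absval t' \<le> m"
      using that by (auto simp: ij S1_def m_def)
    then have "absval (par_y a' b' t') < 1"
      using par_le(2)[of a' m b' t'] by auto
    then show False
      using unit by (simp add: ij matrix_mult_3 conj_simps)
  qed
  obtain C where C: "closed C" "parahoric c = U \<inter> C"
    using parahoric_closed by blast
  have "emeasure M integral_unitary = of_nat (card I) * emeasure M (parahoric c)"
  proof (rule emeasure_cosets[OF haar _ _ C(2,1), of I r])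
    show "finite I"
      using finS by (simp add: I_def)
    show "integral_unitary \<subseteq> U"
      by (auto simp: integral_unitary_def)
    then show "r i \<in> U" if "i \<in> I" for i
      using rint that by blast
    show "g ** adj h \<in> parahoric c" if "g \<in> parahoric c" "h \<in> parahoric c" for g h
      using that by (intro parahoric_mult parahoric_adj)
    show "r i ** h \<in> integral_unitary" if "i \<in> I" "h \<in> parahoric c" for i h
      using that rint by (intro integral_unitary_mult) (auto simp: parahoric_def)
    show "\<exists>i\<in>I. adj (r i) ** g \<in> parahoric c" if g: "g \<in> integral_unitary" for g
    proof (cases "absval (g $ 1 $ 1) = 1")
      case True
      obtain a b t where abt: "a \<in> S" "b \<in> S" "t \<in> S" "adj (npar (a, b, t)) ** g \<in> parahoric c"
        by (rule npar_cover[OF g True S c])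
      then show ?thesis
        by (intro bexI[of _ "Inl (a, b, t)"]) (auto simp: I_def r_def)
    next
      case False
      then have g11: "absval (g $ 1 $ 1) < 1"
        using g by (auto simp: integral_unitary_iff)
      have gU: "g \<in> U"
        using g by (simp add: integral_unitary_def)
      note gb = g[unfolded integral_unitary_iff]
      have "absval (- (\<sigma> (g $ 3 $ 1) * g $ 1 $ 1 + \<sigma> (g $ 1 $ 1) * g $ 3 $ 1)) < 1"
        unfolding absval_minus using gb g11
        by (intro absval_add_less) (auto intro: absval_mult_less_left absval_mult_less_right)
      moreover have "\<sigma> (g $ 2 $ 1) * g $ 2 $ 1 = - (\<sigma> (g $ 3 $ 1) * g $ 1 $ 1 + \<sigma> (g $ 1 $ 1) * g $ 3 $ 1)"
        using unitary_relations(4)[OF gU] by (simp add: eq_neg_iff_add_eq_0 algebra_simps)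
      ultimately have "absval (g $ 2 $ 1) ^ 2 < 1"
        by (metis absval_conj absval_mult power2_eq_square)
      then have g21: "absval (g $ 2 $ 1) < 1"
        by (simp add: abs_square_less_1)
      have g31: "absval (g $ 3 $ 1) = 1"
      proof (rule ccontr)
        assume "absval (g $ 3 $ 1) \<noteq> 1"
        then have "absval (\<sigma> (g $ 3 $ 3) * g $ 1 $ 1 + \<sigma> (g $ 2 $ 3) * g $ 2 $ 1 + \<sigma> (g $ 1 $ 3) * g $ 3 $ 1) < 1"
          using gb g11 g21 by (intro absval_add_less absval_mult_less_left) auto
        then show False
          using unitary_relations(1)[OF gU] by simp
      qed
      let ?g = "antidiag_J ** g"
      have Jg: "?g $ 1 $ 1 = g $ 3 $ 1" "?g $ 2 $ 1 = g $ 2 $ 1" "?g $ 3 $ 1 = g $ 1 $ 1"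
        by (simp_all add: matrix_mult_3)
      have Jgi: "?g \<in> integral_unitary" and Jg1: "absval (?g $ 1 $ 1) = 1"
        using g antidiag_J_integral_unitary g31 by (auto simp: Jg intro: integral_unitary_mult)
      obtain a b t where abt: "a \<in> S" "b \<in> S" "t \<in> S" "adj (npar (a, b, t)) ** ?g \<in> parahoric c"
        "absval a < 1 \<and> absval b < 1 \<and> absval t < 1"
        by (rule npar_cover[OF Jgi Jg1 S c]) (use Jg g21 g11 in auto)
      have "adj (antidiag_J ** npar (a, b, t)) ** g = adj (npar (a, b, t)) ** ?g"
        by (simp add: adj_mult adj_antidiag_J matrix_mul_assoc)
      then show ?thesis
        using abt by (intro bexI[of _ "Inr (a, b, t)"]) (auto simp: I_def r_def S1_def)
    qed
    show "i = j" if ij: "i \<in> I" "j \<in> I" "adj (r i) ** r j \<in> parahoric c" for i j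
    proof (cases i; cases j)
      fix i' j' assume "i = Inl i'" "j = Inl j'"
      then show "i = j"
        using disj_npar ij by (auto simp: I_def r_def simp del: case_prod_conv)
    next
      fix i' j' assume *: "i = Inl i'" "j = Inr j'"
      then show "i = j"
        using mixed[of i' j'] ij by (auto simp: I_def r_def simp del: case_prod_conv)
    next
      fix i' j' assume *: "i = Inr i'" "j = Inl j'"
      have "adj (adj (r i) ** r j) \<in> parahoric c"
        using ij(3) by (rule parahoric_adj)
      then show "i = j"
        using mixed[of j' i'] ij * by (auto simp: I_def r_def adj_mult simp del: case_prod_conv)
    next
      fix i' j' assume *: "i = Inr i'" "j = Inr j'"
      have "adj (antidiag_J ** npar i') ** (antidiag_J ** npar j') = adj (npar i') ** npar j'"
        using antidiag_J_integral_unitary unfolding integral_unitary_def adj_mult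
        by (simp only: matrix_mul_assoc[symmetric] adj_mult_cancel mem_Collect_eq)
      then show "i = j"
        using disj_npar[of i' j'] S1S ij * by (auto simp: I_def r_def simp del: case_prod_conv)
    qed
  qed
  moreover have "card I = card S ^ 3 + card S1 ^ 3"
    using finS by (simp add: I_def card_Plus card_cartesian_product power3_eq_cube)
  ultimately show ?thesis
    by (simp add: S1_def)
qed


section \<open>Cosets indexed by the projective line\<close>

text \<open>Homogeneous coordinates of the points of the projective line over the integers of \<open>F\<close> modulo \<open>c\<close>.\<close>

definition line_reps :: "'f set \<Rightarrow> ('f \<times> 'f) set" where
  "line_reps S = {1} \<times> S \<union> {s \<in> S. absval s < 1} \<times> {1}"

lemma line_reps_finite: "residue_system S c \<Longrightarrow> finite (line_reps S)"
  by (simp add: line_reps_def residue_system_def)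

lemma line_reps_bounds:
  assumes "residue_system S c" "(\<alpha>, \<beta>) \<in> line_reps S"
  shows "absval \<alpha> \<le> 1" "absval \<beta> \<le> 1" "max (absval \<alpha>) (absval \<beta>) = 1"
  using assms by (auto simp: line_reps_def residue_system_def)

text \<open>Divide by a coordinate of absolute value 1, the first one whenever possible, and round
  the other to a representative. In the second case \<open>c < 1\<close> keeps the rounded value
  below 1.\<close>

lemma line_reps_cover:
  assumes S: "residue_system S c" and c: "c < 1" and ab: "max (absval a) (absval b) = 1"
  obtains \<alpha> \<beta> where "(\<alpha>, \<beta>) \<in> line_reps S" "absval (\<alpha> * b - \<beta> * a) \<le> c"
proof -
  have rep: "\<exists>s\<in>S. absval (x - s) \<le> c" if "absval x \<le> 1" for x
    using S that by (auto simp: residue_system_def)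
  show thesis
  proof (cases "absval a = 1")
    case True
    moreover have "absval b \<le> 1"
      using ab by linarith
    ultimately obtain \<beta> where \<beta>: "\<beta> \<in> S" "absval (b / a - \<beta>) \<le> c"
      using rep[of "b / a"] by (auto simp: absval_divide)
    have "1 * b - \<beta> * a = (b / a - \<beta>) * a"
      using True by (auto simp: field_simps)
    then have "absval (1 * b - \<beta> * a) \<le> c"
      using \<beta> True by (simp add: absval_mult)
    then show thesis
      using \<beta> by (intro that[of 1 \<beta>]) (auto simp: line_reps_def)
  next
    case False
    then have b: "absval b = 1" and a: "absval a < 1"
      using ab by (auto simp: max_def split: if_splits)
    then have ba: "absval (a / b) < 1"
      by (simp add: absval_divide)
    then obtain \<alpha> where \<alpha>: "\<alpha> \<in> S" "absval (a / b - \<alpha>) \<le> c"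
      using rep[of "a / b"] by auto
    have "absval \<alpha> < 1"
      using absval_diff_less[OF ba, of "a / b - \<alpha>"] \<alpha> c by simp
    moreover have "\<alpha> * b - 1 * a = - ((a / b - \<alpha>) * b)"
      using b by (auto simp: field_simps)
    then have "absval (\<alpha> * b - 1 * a) \<le> c"
      using \<alpha> b by (simp add: absval_mult)
    ultimately show thesis
      using \<alpha> by (intro that[of \<alpha> 1]) (auto simp: line_reps_def)
  qed
qed

text \<open>Within one chart this is uniqueness of representatives. Points of different charts have
  cross product \<open>1 - x * y\<close> up to sign, where \<open>y\<close> is not a unit, and its
  absolute value 1 exceeds \<open>c\<close>.\<close>

lemma line_reps_unique:
  assumes S: "residue_system S c" and c: "c < 1"
    and T: "(\<alpha>, \<beta>) \<in> line_reps S" "(\<alpha>', \<beta>') \<in> line_reps S" "absval (\<alpha> * \<beta>' - \<beta> * \<alpha>') \<le> c"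
  shows "(\<alpha>, \<beta>) = (\<alpha>', \<beta>')"
proof -
  have uniq: "s = t" if "s \<in> S" "t \<in> S" "absval (s - t) \<le> c" for s t
    using S that by (auto simp: residue_system_def)
  have mixed: "\<not> absval (1 - x * y) \<le> c" if "absval x \<le> 1" "absval y < 1" for x y :: 'f
  proof
    assume "absval (1 - x * y) \<le> c"
    then have "absval ((1 - x * y) + x * y) < 1"
      using absval_mult_less_left[OF that] c by (intro absval_add_less[of "1 - x * y"]) auto
    then show False
      by simp
  qed
  have le: "s \<in> S \<Longrightarrow> absval s \<le> 1" for s
    using S by (auto simp: residue_system_def)
  consider "\<alpha> = 1" "\<alpha>' = 1" "\<beta> \<in> S" "\<beta>' \<in> S"
    | "\<alpha> = 1" "\<beta> \<in> S" "\<beta>' = 1" "absval \<alpha>' < 1"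
    | "\<alpha>' = 1" "\<beta>' \<in> S" "\<beta> = 1" "absval \<alpha> < 1"
    | "\<beta> = 1" "\<beta>' = 1" "\<alpha> \<in> S" "\<alpha>' \<in> S"
    using T(1,2) by (auto simp: line_reps_def)
  then show ?thesis
  proof cases
    case 1
    then show ?thesis
      using T(3) uniq[of \<beta>' \<beta>] by simp
  next
    case 2
    then show ?thesis
      using T(3) mixed[of \<beta> \<alpha>'] le by simp
  next
    case 3
    then show ?thesis
      using T(3) mixed[of \<beta>' \<alpha>] le absval_minus_commute[of "\<alpha> * \<beta>'" 1] by (simp add: mult.commute)
  next
    case 4
    then show ?thesis
      using T(3) uniq[of \<alpha> \<alpha>'] by simp
  qed
qed

section \<open>Norm-one elements and the index of H_n in K_n\<close>

lemma absval_par_x: "absval (par_x a b) = max (absval a) (absval b)"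
  by (simp add: par_x_def absval_decomposition)

text \<open>For units \<open>z\<close> and \<open>z'\<close> this compares
  \<open>z / \<sigma> z\<close> with \<open>z' / \<sigma> z'\<close>: they agree modulo
  \<open>c\<close> exactly when the coordinates in F give the same point of the projective line
  modulo \<open>c\<close>.\<close>

lemma par_x_cross:
  "\<sigma> (par_x a b) * par_x a' b' - par_x a b * \<sigma> (par_x a' b') = d * \<iota> (a * b' - b * a')"
  by (simp add: par_x_def d_def hom conj_simps algebra_simps)

definition middle_diag :: "'e \<Rightarrow> 'e^3^3" where
  "middle_diag z = vector [vector [1, 0, 0], vector [0, z / \<sigma> z, 0], vector [0, 0, 1]]"

lemma middle_diag_entries [simp]:
  "middle_diag z $ 1 $ 1 = 1" "middle_diag z $ 1 $ 2 = 0" "middle_diag z $ 1 $ 3 = 0"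
  "middle_diag z $ 2 $ 1 = 0" "middle_diag z $ 2 $ 2 = z / \<sigma> z" "middle_diag z $ 2 $ 3 = 0"
  "middle_diag z $ 3 $ 1 = 0" "middle_diag z $ 3 $ 2 = 0" "middle_diag z $ 3 $ 3 = 1"
  by (simp_all add: middle_diag_def)

lemma middle_diag_parahoric:
  assumes "absval z = 1" "0 \<le> c"
  shows "middle_diag z \<in> parahoric c"
proof -
  have "z \<noteq> 0" "\<sigma> z \<noteq> 0"
    using assms absval_conj[of z] by (metis absval_0 zero_neq_one)+
  then have "middle_diag z \<in> U"
    by (simp add: unitary_iff matrix_3_eq_iff matrix_mult_3 conj_simps)
  then show ?thesis
    using assms by (simp add: parahoric_def integral_unitary_iff absval_divide)
qed

text \<open>
  This is Hilbert 90 modulo \<open>c\<close>: a unit of norm \<open>1\<close> is \<open>z / \<sigma> z\<close> with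
  \<open>z = v + u * \<sigma> v\<close>, and \<open>v = 1\<close> or \<open>v = w\<close> makes \<open>z\<close> a unit.
\<close>

lemma hilbert_90_approx:
  assumes u: "absval u = 1" and N: "absval (u * \<sigma> u - 1) \<le> c"
  obtains z where "absval z = 1" "absval (u * \<sigma> z - z) \<le> c"
proof -
  have "\<exists>v. absval v = 1 \<and> absval (v + u * \<sigma> v) = 1"
  proof (cases "absval (1 + u) = 1")
    case True
    then show ?thesis
      by (intro exI[of _ 1]) (simp add: conj_simps)
  next
    case False
    moreover have "absval (1 + u) \<le> 1"
      using u by (intro absval_add_le) auto
    \<comment> \<open>\<open>w + u * \<sigma> w\<close> differs from the unit \<open>d\<close> by
      \<open>(1 + u) * \<sigma> w\<close>, which is small in this case.\<close>
    ultimately have "absval ((1 + u) * \<sigma> w) < absval d"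
      by (simp add: absval_mult)
    then have "absval (d + (1 + u) * \<sigma> w) = 1"
      using absval_add_eq_left by fastforce
    moreover have "d + (1 + u) * \<sigma> w = w + u * \<sigma> w"
      by (simp add: d_def algebra_simps)
    ultimately show ?thesis
      using absval_w by metis
  qed
  then obtain v where v: "absval v = 1" "absval (v + u * \<sigma> v) = 1"
    by blast
  have "u * \<sigma> (v + u * \<sigma> v) - (v + u * \<sigma> v) = (u * \<sigma> u - 1) * v"
    by (simp add: conj_simps algebra_simps)
  then show thesis
    using N v by (intro that[of "v + u * \<sigma> v"]) (auto simp: absval_mult)
qed

text \<open>The middle column has norm 1 and its (3,2) entry is at most \<open>c\<close>, so the
  middle entry has norm 1 modulo \<open>c\<close>. Hilbert 90 yields a \<open>z\<close> whose
  coordinates are the point that labels the coset.\<close>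

lemma emeasure_parahoric:
  fixes S :: "'f set"
  assumes haar: "left_haar_measure U (**) M"
    and S: "residue_system S c" and c: "0 < c" "c < 1"
  shows "emeasure M (parahoric c) = of_nat (card (line_reps S)) * emeasure M (parahoric1 c)"
proof -
  define r where "r = (\<lambda>(\<alpha>, \<beta>). middle_diag (par_x \<alpha> \<beta>))"
  have unit: "absval (par_x \<alpha> \<beta>) = 1" if "(\<alpha>, \<beta>) \<in> line_reps S" for \<alpha> \<beta>
    using line_reps_bounds[OF S that] by (simp add: absval_par_x)
  have r: "r i \<in> parahoric c" if "i \<in> line_reps S" for i
    using that unit c by (cases i) (auto simp: r_def intro: middle_diag_parahoric)
  obtain C where C: "closed C" "parahoric1 c = U \<inter> C"
    using parahoric1_closed by blast
  show ?thesis
  proof (rule emeasure_cosets[OF haar line_reps_finite[OF S] _ C(2,1), of r])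
    show "r i \<in> U" if "i \<in> line_reps S" for i
      using r[OF that] by (simp add: parahoric_def integral_unitary_def)
    show "g ** adj h \<in> parahoric1 c" if "g \<in> parahoric1 c" "h \<in> parahoric1 c" for g h
      using that by (intro parahoric1_mult parahoric1_adj)
    show "parahoric c \<subseteq> U"
      by (auto simp: parahoric_def integral_unitary_def)
    show "r i ** h \<in> parahoric c" if "i \<in> line_reps S" "h \<in> parahoric1 c" for i h
      using that r by (intro parahoric_mult) (auto simp: parahoric1_def)
  next
    fix g assume g: "g \<in> parahoric c"
    let ?u = "g $ 2 $ 2"
    note gb = g[unfolded parahoric_def integral_unitary_iff mem_Collect_eq]
    have eq: "?u * \<sigma> ?u - 1 = - (\<sigma> (g $ 3 $ 2) * g $ 1 $ 2 + \<sigma> (g $ 1 $ 2) * g $ 3 $ 2)"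
      using unitary_relations(3)[of g] gb by (simp add: algebra_simps add_eq_0_iff)
    have N: "absval (?u * \<sigma> ?u - 1) \<le> c"
      unfolding eq absval_minus using gb
      by (intro absval_add_le absval_mult_le_right[of "\<sigma> (g $ 3 $ 2)"] absval_mult_le_left[of "\<sigma> (g $ 1 $ 2)"])
         auto
    have "absval (?u * \<sigma> ?u - 1 + 1) = 1"
      using N c by (subst absval_add_eq_right) auto
    then have "absval ?u * absval ?u = 1"
      by (simp add: absval_mult)
    then have u: "absval ?u = 1"
      using absval_nonneg[of ?u] by (metis abs_of_nonneg abs_square_eq_1 power2_eq_square)
    obtain z where z: "absval z = 1" "absval (?u * \<sigma> z - z) \<le> c"
      using hilbert_90_approx[OF u N] .
    obtain a b where ab: "z = par_x a b"
      using decomposition[of z] by (auto simp: par_x_def)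
    obtain \<alpha> \<beta> where T: "(\<alpha>, \<beta>) \<in> line_reps S" "absval (\<alpha> * b - \<beta> * a) \<le> c"
      using line_reps_cover[OF S c(2), of a b] z ab by (metis absval_par_x)
    let ?x = "par_x \<alpha> \<beta>"
    have x: "absval ?x = 1"
      using unit T by blast
    then have x0: "?x \<noteq> 0" "\<sigma> ?x \<noteq> 0"
      using absval_conj[of ?x] by (metis absval_0 zero_neq_one)+
    \<comment> \<open>The first summand is the error of Hilbert 90, the second that of replacing
      \<open>(a, b)\<close> by \<open>(\<alpha>, \<beta>)\<close>. Together they measure how far the
      middle entry of \<open>adj (middle_diag ?x) ** g\<close> is from 1.\<close>
    have "absval (\<sigma> ?x * (?u * \<sigma> z - z) + d * \<iota> (\<alpha> * b - \<beta> * a)) \<le> c"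
      by (intro absval_add_le absval_mult_le_left) (use x z T in auto)
    moreover have cross: "d * \<iota> (\<alpha> * b - \<beta> * a) = \<sigma> ?x * z - ?x * \<sigma> z"
      using par_x_cross[of \<alpha> \<beta> a b] by (simp add: ab)
    have "\<sigma> ?x * (?u * \<sigma> z - z) + d * \<iota> (\<alpha> * b - \<beta> * a) = (\<sigma> ?x / ?x * ?u - 1) * (?x * \<sigma> z)"
      using x0 by (simp add: cross field_simps)
    ultimately have "absval (\<sigma> ?x / ?x * ?u - 1) \<le> c"
      using x z by (simp add: absval_mult)
    then have "absval ((adj (middle_diag ?x) ** g) $ 2 $ 2 - 1) \<le> c"
      by (simp add: matrix_mult_3 conj_simps)
    moreover have "adj (middle_diag ?x) ** g \<in> parahoric c"
      using g x c by (intro parahoric_mult parahoric_adj middle_diag_parahoric) auto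
    ultimately show "\<exists>i\<in>line_reps S. adj (r i) ** g \<in> parahoric1 c"
      using T(1) by (intro bexI[of _ "(\<alpha>, \<beta>)"]) (simp_all add: r_def parahoric1_def)
  next
    fix i j assume ij: "i \<in> line_reps S" "j \<in> line_reps S" "adj (r i) ** r j \<in> parahoric1 c"
    obtain \<alpha> \<beta> \<alpha>' \<beta>' where e: "i = (\<alpha>, \<beta>)" "j = (\<alpha>', \<beta>')"
      by (metis prod.exhaust)
    let ?x = "par_x \<alpha> \<beta>" and ?x' = "par_x \<alpha>' \<beta>'"
    have x: "absval ?x = 1" "absval ?x' = 1"
      using unit ij e by blast+
    then have x0: "?x \<noteq> 0" "\<sigma> ?x \<noteq> 0" "?x' \<noteq> 0" "\<sigma> ?x' \<noteq> 0"
      using absval_conj[of ?x] absval_conj[of ?x'] by (metis absval_0 zero_neq_one)+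
    have "absval (\<sigma> ?x / ?x * (?x' / \<sigma> ?x') - 1) \<le> c"
      using ij(3) by (simp add: e r_def parahoric1_def matrix_mult_3 conj_simps)
    moreover have cross: "d * \<iota> (\<alpha> * \<beta>' - \<beta> * \<alpha>') = \<sigma> ?x * ?x' - ?x * \<sigma> ?x'"
      by (simp add: par_x_cross)
    have "d * \<iota> (\<alpha> * \<beta>' - \<beta> * \<alpha>') = (\<sigma> ?x / ?x * (?x' / \<sigma> ?x') - 1) * (?x * \<sigma> ?x')"
      unfolding cross using x0 by (simp add: field_simps)
    then have "absval (d * \<iota> (\<alpha> * \<beta>' - \<beta> * \<alpha>')) = absval ((\<sigma> ?x / ?x * (?x' / \<sigma> ?x') - 1) * (?x * \<sigma> ?x'))"
      by (rule arg_cong)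
    ultimately have "absval (\<alpha> * \<beta>' - \<beta> * \<alpha>') \<le> c"
      using x by (simp add: absval_mult)
    then show "i = j"
      using line_reps_unique[OF S c(2)] ij e by blast
  qed
qed

text \<open>The outer block is the matrix with rows \<open>(e, b)\<close> and \<open>(f, a)\<close>,
  conjugated by the diagonal matrix with entries \<open>1\<close> and \<open>d * Q\<close>. The
  scale \<open>Q\<close> matches the bounds of \<open>miyauchi\<close>; since
  \<open>\<sigma> d = - d\<close>, unitarity becomes \<open>e * a - f * b = 1\<close> when
  \<open>Q\<close> and the four entries are fixed by \<open>\<sigma>\<close>.\<close>

definition sl2_block :: "'e \<Rightarrow> 'e \<Rightarrow> 'e \<Rightarrow> 'e \<Rightarrow> 'e \<Rightarrow> 'e^3^3" where
  "sl2_block Q a b e f =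
     vector [vector [e, 0, b / (d * Q)], vector [0, 1, 0], vector [d * Q * f, 0, a]]"

lemma sl2_block_entries [simp]:
  "sl2_block Q a b e f $ 1 $ 1 = e" "sl2_block Q a b e f $ 1 $ 2 = 0" "sl2_block Q a b e f $ 1 $ 3 = b / (d * Q)"
  "sl2_block Q a b e f $ 2 $ 1 = 0" "sl2_block Q a b e f $ 2 $ 2 = 1" "sl2_block Q a b e f $ 2 $ 3 = 0"
  "sl2_block Q a b e f $ 3 $ 1 = d * Q * f" "sl2_block Q a b e f $ 3 $ 2 = 0" "sl2_block Q a b e f $ 3 $ 3 = a"
  by (simp_all add: sl2_block_def)

text \<open>The coordinate of \<open>v\<close> along \<open>w\<close> is
  \<open>(v - \<sigma> v) / d\<close>, so dropping it costs at most \<open>c\<close>.\<close>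

lemma approx_fixed_point:
  assumes "absval (v - \<sigma> v) \<le> c" "absval v \<le> 1"
  obtains a where "absval (v - \<iota> a) \<le> c" "absval a \<le> 1"
proof -
  obtain a b where v: "v = \<iota> a + \<iota> b * w"
    using decomposition by blast
  have "v - \<sigma> v = \<iota> b * d"
    by (simp add: v d_def conj_simps algebra_simps)
  then have "absval (v - \<iota> a) \<le> c"
    using assms(1) by (simp add: absval_mult v)
  moreover have "absval a \<le> 1"
    using assms(2) by (simp add: v absval_decomposition)
  ultimately show thesis
    by (rule that)
qed

text \<open>The third column labels the coset of \<open>g\<close>: \<open>g $ 3 $ 3\<close> and
  \<open>d * Q * g $ 1 $ 3\<close> are homogeneous coordinates of a point that isotropy makes
  rational over F modulo \<open>c\<close>.\<close>

lemma emeasure_miyauchi: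
  fixes S :: "'f set" and P :: 'f
  assumes haar: "left_haar_measure U (**) M"
    and S: "residue_system S c" and c: "0 < c" "c < 1" and P: "absval P = c"
  shows "emeasure M (miyauchi c) = of_nat (card (line_reps S)) * emeasure M (parahoric1 c)"
proof -
  define Q where "Q = \<iota> P"
  have Q: "absval Q = c" "\<sigma> Q = Q"
    using P by (simp_all add: Q_def)
  moreover from Q have "Q \<noteq> 0"
    using c by auto
  ultimately have Q: "absval Q = c" "Q \<noteq> 0" "\<sigma> Q = Q"
    by blast+
  have ci: "1 \<le> inverse c"
    using c by (simp add: one_le_inverse_iff)
  \<comment> \<open>One of \<open>\<alpha>\<close> and \<open>\<beta>\<close> is 1, so determinant 1
    is reached with \<open>(e, f) = (1, 0)\<close> if \<open>\<alpha> = 1\<close> and with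
    \<open>(0, - 1)\<close> otherwise.\<close>
  define r where "r = (\<lambda>(\<alpha>, \<beta>). sl2_block Q (\<iota> \<alpha>) (\<iota> \<beta>) (if \<alpha> = 1 then 1 else 0) (if \<alpha> = 1 then 0 else - 1))"
  have r: "\<exists>a b e f. r (\<alpha>, \<beta>) = sl2_block Q a b e f \<and> a = \<iota> \<alpha> \<and> b = \<iota> \<beta> \<and> e * a - f * b = 1 \<and>
      \<sigma> a = a \<and> \<sigma> b = b \<and> \<sigma> e = e \<and> \<sigma> f = f \<and>
      absval a \<le> 1 \<and> absval b \<le> 1 \<and> absval e \<le> 1 \<and> absval f \<le> 1"
    if "(\<alpha>, \<beta>) \<in> line_reps S" for \<alpha> \<beta>
    using line_reps_bounds[OF S that] that
    by (intro exI[of _ "\<iota> \<alpha>"] exI[of _ "\<iota> \<beta>"] exI[of _ "if \<alpha> = 1 then 1 else 0"]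
        exI[of _ "if \<alpha> = 1 then 0 else - 1"]) (auto simp: r_def line_reps_def hom conj_simps)
  \<comment> \<open>Division by \<open>Q\<close> loses a factor \<open>c\<close>: third-row entries
    bounded by \<open>c\<close> take \<open>k = 1\<close>, and the (3,3) entry takes
    \<open>k = inverse c\<close>.\<close>
  have div_le: "absval (b / (d * Q) * y) \<le> k" if "absval b \<le> 1" "absval y \<le> c * k" for b y k
  proof -
    have "absval b * absval y \<le> c * k"
      using that absval_mult_le_left[of b y "c * k"] by (simp add: absval_mult)
    then show ?thesis
      using c Q by (simp add: absval_mult absval_divide field_simps)
  qed
  have mult_le: "absval (d * Q * f * y) \<le> c" if "absval f \<le> 1" "absval y \<le> 1" for f y
    using that Q by (intro absval_mult_le_right[of _ c y] absval_mult_le_right[of _ c f]) (auto simp: absval_mult)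
  obtain C where C: "closed C" "parahoric1 c = U \<inter> C"
    using parahoric1_closed by blast
  have rU: "r i \<in> U" if i: "i \<in> line_reps S" for i
  proof (cases i)
    case (Pair \<alpha> \<beta>)
    then obtain a b e f where "r i = sl2_block Q a b e f" "e * a - f * b = 1"
      "\<sigma> a = a" "\<sigma> b = b" "\<sigma> e = e" "\<sigma> f = f"
      using r[of \<alpha> \<beta>] i by blast
    then show ?thesis
      using Q by (simp add: unitary_iff matrix_3_eq_iff matrix_mult_3 conj_simps algebra_simps)
  qed
  show ?thesis
  proof (rule emeasure_cosets[OF haar line_reps_finite[OF S] rU C(2,1)])
    show "g ** adj h \<in> parahoric1 c" if "g \<in> parahoric1 c" "h \<in> parahoric1 c" for g h
      using that by (intro parahoric1_mult parahoric1_adj)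
    show "miyauchi c \<subseteq> U"
      by (auto simp: miyauchi_def)
  next
    fix i h assume i: "i \<in> line_reps S" and h: "h \<in> parahoric1 c"
    obtain \<alpha> \<beta> where "i = (\<alpha>, \<beta>)"
      by (cases i)
    then obtain a b e f where m: "r i = sl2_block Q a b e f"
      and le: "absval a \<le> 1" "absval b \<le> 1" "absval e \<le> 1" "absval f \<le> 1"
      using r i by blast
    note hb = h[unfolded parahoric1_def parahoric_def integral_unitary_iff mem_Collect_eq]
    have "r i ** h \<in> U"
      using rU[OF i] hb by (simp add: unitary_mult)
    moreover have "absval (e * h $ 1 $ 1 + b / (d * Q) * h $ 3 $ 1) \<le> 1"
      "absval (e * h $ 1 $ 2 + b / (d * Q) * h $ 3 $ 2) \<le> 1"
      using hb le by - ((intro absval_add_le absval_mult_le_left[of e] div_le; simp)+)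
    moreover have "absval (e * h $ 1 $ 3 + b / (d * Q) * h $ 3 $ 3) \<le> inverse c"
      using hb le ci c absval_mult_le_left[of e "h $ 1 $ 3" 1] by (intro absval_add_le div_le) auto
    moreover have "absval (d * Q * f * h $ 1 $ 1 + a * h $ 3 $ 1) \<le> c"
      "absval (d * Q * f * h $ 1 $ 2 + a * h $ 3 $ 2) \<le> c"
      using hb le by - ((intro absval_add_le absval_mult_le_left[of a] mult_le; simp)+)
    moreover have "absval (d * Q * f * h $ 1 $ 3 + a * h $ 3 $ 3) \<le> 1"
      using hb le c mult_le[of f "h $ 1 $ 3"] by (auto intro!: absval_add_le absval_mult_le_left[of a])
    ultimately show "r i ** h \<in> miyauchi c"
      using hb by (simp add: miyauchi_def m matrix_mult_3)
  next
    fix g assume g: "g \<in> miyauchi c"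
    note gb = g[unfolded miyauchi_def mem_Collect_eq]
    define X where "X = d * Q * g $ 1 $ 3"
    let ?s = "g $ 3 $ 3"
    have g13: "absval (g $ 1 $ 3) = absval X / c"
      using c Q by (simp add: X_def absval_mult)
    then have X: "absval X \<le> 1"
      using gb c by (simp add: field_simps)
    have "\<sigma> X = - d * Q * \<sigma> (g $ 1 $ 3)"
      using Q by (simp add: X_def conj_simps)
    \<comment> \<open>Since \<open>\<sigma> d = - d\<close>, isotropy of the third column says that
      \<open>\<sigma> ?s * X\<close> is fixed by \<open>\<sigma>\<close> up to a multiple of
      \<open>Q\<close>.\<close>
    then have "\<sigma> ?s * X - \<sigma> X * ?s = d * Q * (\<sigma> ?s * g $ 1 $ 3 + \<sigma> (g $ 1 $ 3) * ?s)"
      by (simp add: X_def algebra_simps)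
    also have "\<sigma> ?s * g $ 1 $ 3 + \<sigma> (g $ 1 $ 3) * ?s = - (\<sigma> (g $ 2 $ 3) * g $ 2 $ 3)"
      using unitary_relations(2)[of g] gb by (simp add: eq_neg_iff_add_eq_0 algebra_simps)
    finally have eq: "\<sigma> ?s * X - \<sigma> X * ?s = d * Q * 1 * (- (\<sigma> (g $ 2 $ 3) * g $ 2 $ 3))"
      by simp
    have "absval (\<sigma> (g $ 2 $ 3) * g $ 2 $ 3) \<le> 1"
      using gb by (intro absval_mult_le_left) auto
    then have Xs: "absval (\<sigma> ?s * X - \<sigma> X * ?s) \<le> c"
      unfolding eq by (intro mult_le) simp_all
    \<comment> \<open>The coordinates are primitive, for otherwise the product of the first and
      third columns would be below 1.\<close>
    have "absval ?s = 1 \<or> absval X = 1"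
    proof (rule ccontr)
      assume "\<not> ?thesis"
      then have less: "absval ?s < 1" "absval X < 1"
        using X gb by auto
      have "absval (\<sigma> (g $ 1 $ 3) * g $ 3 $ 1) \<le> absval X / c * c"
        unfolding absval_mult absval_conj g13 using gb c by (intro mult_left_mono) auto
      then have "absval (\<sigma> (g $ 1 $ 3) * g $ 3 $ 1) < 1"
        using less c by simp
      moreover have "absval (\<sigma> ?s * g $ 1 $ 1) < 1" "absval (\<sigma> (g $ 2 $ 3) * g $ 2 $ 1) < 1"
        using less gb c by (auto intro: absval_mult_less_right absval_mult_less_left)
      ultimately have "absval (\<sigma> ?s * g $ 1 $ 1 + \<sigma> (g $ 2 $ 3) * g $ 2 $ 1 + \<sigma> (g $ 1 $ 3) * g $ 3 $ 1) < 1"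
        by (intro absval_add_less)
      then show False
        using unitary_relations(1)[of g] gb by simp
    qed
    \<comment> \<open>The quotient of the two coordinates, with a unit as denominator, is moved by
      \<open>\<sigma>\<close> by at most \<open>c\<close>, so it lies within \<open>c\<close> of F
      and can be rounded there.\<close>
    then obtain \<alpha> \<beta> where T: "(\<alpha>, \<beta>) \<in> line_reps S" and close: "absval (\<iota> \<alpha> * X - \<iota> \<beta> * ?s) \<le> c"
    proof
      assume s: "absval ?s = 1"
      then have s0: "?s \<noteq> 0" "\<sigma> ?s \<noteq> 0"
        using absval_conj[of ?s] by (metis absval_0 zero_neq_one)+
      define v where "v = X / ?s"
      have v1: "absval v \<le> 1"
        using X s by (simp add: v_def absval_divide)
      have "v - \<sigma> v = (\<sigma> ?s * X - \<sigma> X * ?s) / (?s * \<sigma> ?s)"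
        using s0 by (simp add: v_def conj_simps field_simps)
      then have "absval (v - \<sigma> v) \<le> c"
        using Xs s by (simp add: absval_divide absval_mult)
      then obtain a where a: "absval (v - \<iota> a) \<le> c" "absval a \<le> 1"
        using approx_fixed_point v1 by blast
      then have "max (absval (1 :: 'f)) (absval a) = 1"
        by simp
      then obtain \<alpha> \<beta> where T: "(\<alpha>, \<beta>) \<in> line_reps S" "absval (\<alpha> * a - \<beta> * 1) \<le> c"
        by (rule line_reps_cover[OF S c(2)])
      have "\<iota> \<alpha> * X - \<iota> \<beta> * ?s = (\<iota> \<alpha> * (v - \<iota> a) + \<iota> (\<alpha> * a - \<beta> * 1)) * ?s"
        using s0 by (simp add: v_def hom algebra_simps)
      moreover have "absval (\<iota> \<alpha> * (v - \<iota> a) + \<iota> (\<alpha> * a - \<beta> * 1)) \<le> c"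
        using T a line_reps_bounds[OF S T(1)] by (intro absval_add_le absval_mult_le_left[of "\<iota> \<alpha>"]) auto
      ultimately show thesis
        using that T s by (simp add: absval_mult)
    next
      assume s: "absval X = 1"
      then have s0: "X \<noteq> 0" "\<sigma> X \<noteq> 0"
        using absval_conj[of X] by (metis absval_0 zero_neq_one)+
      define v where "v = ?s / X"
      have v1: "absval v \<le> 1"
        using gb s by (simp add: v_def absval_divide)
      have "v - \<sigma> v = - ((\<sigma> ?s * X - \<sigma> X * ?s) / (X * \<sigma> X))"
        using s0 by (simp add: v_def conj_simps field_simps)
      then have "absval (v - \<sigma> v) \<le> c"
        using Xs s by (simp add: absval_divide absval_mult)
      then obtain a where a: "absval (v - \<iota> a) \<le> c" "absval a \<le> 1"
        using approx_fixed_point v1 by blast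
      then have "max (absval a) (absval (1 :: 'f)) = 1"
        by simp
      then obtain \<alpha> \<beta> where T: "(\<alpha>, \<beta>) \<in> line_reps S" "absval (\<alpha> * 1 - \<beta> * a) \<le> c"
        by (rule line_reps_cover[OF S c(2)])
      have "\<iota> \<alpha> * X - \<iota> \<beta> * ?s = (\<iota> (\<alpha> * 1 - \<beta> * a) - \<iota> \<beta> * (v - \<iota> a)) * X"
        using s0 by (simp add: v_def hom algebra_simps)
      moreover have "absval (\<iota> (\<alpha> * 1 - \<beta> * a) - \<iota> \<beta> * (v - \<iota> a)) \<le> c"
        using T a line_reps_bounds[OF S T(1)]
        by (intro absval_diff_le[of "\<iota> (\<alpha> * 1 - \<beta> * a)"] absval_mult_le_left[of "\<iota> \<beta>"]) auto
      ultimately show thesis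
        using that T s by (simp add: absval_mult)
    qed
    obtain a b e f where m: "r (\<alpha>, \<beta>) = sl2_block Q a b e f" "a = \<iota> \<alpha>" "b = \<iota> \<beta>"
      and \<sigma>: "\<sigma> a = a" "\<sigma> b = b" "\<sigma> e = e" "\<sigma> f = f"
      and le: "absval a \<le> 1" "absval b \<le> 1" "absval e \<le> 1" "absval f \<le> 1"
      using r[OF T] by blast
    let ?h = "adj (r (\<alpha>, \<beta>)) ** g"
    have "absval (a * g $ 1 $ 1 - b / (d * Q) * g $ 3 $ 1) \<le> 1"
      "absval (a * g $ 1 $ 2 - b / (d * Q) * g $ 3 $ 2) \<le> 1"
      using gb le by - ((intro absval_diff_le absval_mult_le_left[of a] div_le; simp)+)
    \<comment> \<open>Here the choice of representative matters: the numerator of the (1,3) entry is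
      the cross product bounded by \<open>close\<close>.\<close>
    moreover have "a * g $ 1 $ 3 - b / (d * Q) * ?s = (a * X - b * ?s) / (d * Q)"
      using Q by (simp add: X_def field_simps)
    then have "absval (a * g $ 1 $ 3 - b / (d * Q) * ?s) \<le> 1"
      using close c Q by (simp add: m absval_divide absval_mult)
    moreover have "absval (e * g $ 3 $ 1 - d * Q * f * g $ 1 $ 1) \<le> c"
      "absval (e * g $ 3 $ 2 - d * Q * f * g $ 1 $ 2) \<le> c"
      using gb le by - ((intro absval_diff_le absval_mult_le_left[of e] mult_le; simp)+)
    moreover have "absval (e * ?s - f * X) \<le> 1"
      using gb le X by (auto intro!: absval_diff_le absval_mult_le_left)
    then have "absval (e * ?s - d * Q * f * g $ 1 $ 3) \<le> 1"
      by (simp add: X_def algebra_simps)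
    moreover have "absval ((g $ 2 $ 2 - 1) + 1) \<le> 1"
      using gb c by (intro absval_add_le) auto
    moreover have "?h \<in> U"
      using rU[OF T] gb by (simp add: unitary_mult unitary_adj)
    ultimately have "?h \<in> parahoric1 c"
      using gb c Q \<sigma> unfolding parahoric1_def parahoric_def integral_unitary_iff
      by (simp add: m(1) matrix_mult_3 conj_simps)
    then show "\<exists>i\<in>line_reps S. adj (r i) ** g \<in> parahoric1 c"
      using T by blast
  next
    fix i j assume ij: "i \<in> line_reps S" "j \<in> line_reps S" "adj (r i) ** r j \<in> parahoric1 c"
    obtain \<alpha> \<beta> \<alpha>' \<beta>' where e: "i = (\<alpha>, \<beta>)" "j = (\<alpha>', \<beta>')"
      by (metis prod.exhaust)
    have "absval ((adj (r i) ** r j) $ 1 $ 3) \<le> 1"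
      using ij(3) by (simp add: parahoric1_def parahoric_def integral_unitary_def)
    \<comment> \<open>Integrality of this entry bounds the cross product by \<open>c\<close>, so the
      two points coincide.\<close>
    moreover have "(adj (r i) ** r j) $ 1 $ 3 = \<iota> (\<alpha> * \<beta>' - \<beta> * \<alpha>') / (d * Q)"
      using Q by (simp add: e r_def matrix_mult_3 conj_simps hom field_simps)
    ultimately have "absval (\<alpha> * \<beta>' - \<beta> * \<alpha>') \<le> c"
      using c Q by (simp add: absval_divide absval_mult)
    then show "i = j"
      using line_reps_unique[OF S c(2)] ij e by blast
  qed
qed

section \<open>Identification with the Miyauchi subgroups, and the volume\<close>

lemma miyauchi_subgroup_eq:
  "miyauchi_subgroup \<sigma> n = miyauchi (absval p ^ n)"
proof -
  have mp: "maximal_ideal_power k = {x :: 'e. absval x \<le> absval p powi k}" for k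
    using maximal_ideal_power_eq[OF generator_\<iota>p] by simp
  have shift: "x \<in> (+) 1 ` A \<longleftrightarrow> x - 1 \<in> A" for x :: 'e and A
    by (auto intro: image_eqI[of _ _ "x - 1"])
  have unit: "det g \<in> valuation_ring_units" if "g \<in> U" for g
  proof -
    have "absval (det g) = 1" "det g \<noteq> 0"
      using absval_det_unitary[OF that] by auto
    then have "det g \<in> valuation_ring" "inverse (det g) \<in> valuation_ring" "det g * inverse (det g) = 1"
      by (auto simp: valuation_ring_def absval_inverse)
    then show ?thesis
      unfolding valuation_ring_units_def by blast
  qed
  show ?thesis
  proof (rule set_eqI)
    fix g :: "'e^3^3"
    show "g \<in> miyauchi_subgroup \<sigma> n \<longleftrightarrow> g \<in> miyauchi (absval p ^ n)"
      using unit[of g]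
      by (simp only: miyauchi_subgroup_def miyauchi_def mp shift valuation_ring_def power_int_minus
          power_int_of_nat Int_iff mem_Collect_eq) blast
  qed
qed

lemma miyauchi_subgroup_0_eq: "miyauchi_subgroup \<sigma> 0 = integral_unitary"
proof -
  have shift: "absval (x - 1) \<le> 1 \<longleftrightarrow> absval x \<le> 1" for x :: 'e
    using absval_diff_le[of x 1 1] absval_add_le[of "x - 1" 1 1] by auto
  show ?thesis
  proof (rule set_eqI)
    fix g :: "'e^3^3"
    show "g \<in> miyauchi_subgroup \<sigma> 0 \<longleftrightarrow> g \<in> integral_unitary"
      by (simp only: miyauchi_subgroup_eq miyauchi_def integral_unitary_iff shift power_0 inverse_1
          mem_Collect_eq)
  qed
qed

text \<open>Indexing by \<open>Suc n\<close> writes the second exponent as \<open>3 * n\<close>,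
  without subtraction of natural numbers.\<close>

lemma emeasure_miyauchi_subgroup:
  assumes haar: "left_haar_measure U (**) M" and one: "emeasure M (miyauchi_subgroup \<sigma> 0) = 1"
  shows "emeasure M (miyauchi_subgroup \<sigma> (Suc n)) =
    ennreal (inverse (real (residue_card TYPE('f)) ^ (3 * Suc n) + real (residue_card TYPE('f)) ^ (3 * n)))"
proof -
  let ?q = "residue_card TYPE('f)"
  define c where "c = absval p ^ Suc n"
  have p: "0 < absval p" "absval p < 1"
    using generator_p by (auto simp: value_generator_def)
  then have c: "0 < c" "c < 1"
    unfolding c_def by (simp, intro power_Suc_less_one) auto
  obtain S :: "'f set" where S: "residue_system S c" "card S = ?q ^ Suc n"
    "card {s \<in> S. absval s < 1} = ?q ^ n"
    using residue_system_power[OF generator_p, of n] unfolding c_def by blast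
  let ?N = "?q ^ (3 * Suc n) + ?q ^ (3 * n)"
  have "1 = of_nat (card S ^ 3 + card {s \<in> S. absval s < 1} ^ 3) * emeasure M (parahoric c)"
    using emeasure_integral_unitary[OF haar S(1) c] one by (simp add: miyauchi_subgroup_0_eq)
  also have "card S ^ 3 + card {s \<in> S. absval s < 1} ^ 3 = ?N"
    unfolding S(2,3) power_mult[symmetric] by (simp only: mult.commute)
  \<comment> \<open>Both sides are \<open>card (line_reps S)\<close> times the measure of
    \<open>parahoric1 c\<close>; this cardinality is never evaluated.\<close>
  also have "emeasure M (parahoric c) = emeasure M (miyauchi_subgroup \<sigma> (Suc n))"
    using emeasure_parahoric[OF haar S(1) c] emeasure_miyauchi[OF haar S(1) c, of "p ^ Suc n"]
    by (simp add: miyauchi_subgroup_eq c_def absval_power absval_mult)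
  finally have eq: "of_nat ?N * emeasure M (miyauchi_subgroup \<sigma> (Suc n)) = 1"
    by simp
  then have N: "?N \<noteq> 0"
    by (metis mult_zero_left of_nat_0 zero_neq_one)
  \<comment> \<open>An infinite measure would make the product with the nonzero \<open>?N\<close>
    infinite instead of 1.\<close>
  then obtain x where x: "0 \<le> x" "emeasure M (miyauchi_subgroup \<sigma> (Suc n)) = ennreal x"
    using eq by (cases "emeasure M (miyauchi_subgroup \<sigma> (Suc n))") (auto simp: ennreal_mult_top)
  have "ennreal (real ?N * x) = ennreal 1"
    using eq x by (simp only: ennreal_mult'' ennreal_of_nat_eq_real_of_nat ennreal_1)
  then have "real ?N * x = 1"
    using x by (subst (asm) ennreal_inj) auto
  then have "x = inverse (real ?N)"
    using inverse_unique by metis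
  then show ?thesis
    using x by simp
qed

end

theorem theorem2:
  fixes \<iota> :: "'f::{nonarch_local_field, field_char_0} \<Rightarrow> 'e::{nonarch_local_field, field_char_0}"
    and \<sigma> :: "'e \<Rightarrow> 'e"
    and vol :: "('e^3^3) measure"
    and n :: nat
  assumes "unramified_quadratic \<iota>"
    and "\<sigma> \<in> galois_group \<iota>" and "\<sigma> \<noteq> id"
    and "left_haar_measure (unitary_group \<sigma>) (**) vol"
    and "emeasure vol (miyauchi_subgroup \<sigma> 0) = 1"
    and "n \<ge> 1"
  shows "emeasure vol (miyauchi_subgroup \<sigma> n) =
    ennreal (real (residue_card TYPE('f)) powi (- 3 * int n)
             * inverse (1 + real (residue_card TYPE('f)) powi (- 3)))"
proof -
  let ?q = "real (residue_card TYPE('f))"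
  obtain w p where "unramified_involution \<iota> \<sigma> w p"
    using exists_unramified_involution[OF assms(1-3)] .
  then interpret unramified_involution \<iota> \<sigma> w p .
  obtain m where m: "n = Suc m"
    using assms(6) by (cases n) auto
  obtain S :: "'f set" where S: "residue_system S (absval p)" "card S = residue_card TYPE('f)" "0 \<in> S"
    using residue_system_1[OF generator_p] .
  \<comment> \<open>The residue field is not empty, so \<open>?q\<close> is nonzero and its powers
    cancel below.\<close>
  have "card S \<noteq> 0"
    using S(1,3) by (auto simp: residue_system_def)
  then have q: "?q \<noteq> 0"
    using S(2) by simp
  have "?q powi (- 3 * int n) = inverse (?q ^ (3 * Suc m))"
  proof -
    have "- 3 * int n = - int (3 * Suc m)"
      by (simp add: m)
    then show ?thesis
      by (simp only: power_int_minus power_int_of_nat)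
  qed
  moreover have "?q powi (- 3) = inverse (?q ^ 3)"
    by (simp add: power_int_minus)
  moreover have "inverse (?q ^ (3 * Suc m) + ?q ^ (3 * m)) = inverse (?q ^ (3 * Suc m)) * inverse (1 + inverse (?q ^ 3))"
  proof -
    have "?q ^ (3 * Suc m) * (1 + inverse (?q ^ 3)) = ?q ^ (3 * Suc m) + ?q ^ (3 * m)"
      using q by (simp add: power_add field_simps)
    then show ?thesis
      by (metis inverse_mult_distrib)
  qed
  ultimately show ?thesis
    using emeasure_miyauchi_subgroup[OF assms(4,5), of m] by (simp add: m)
qed

end
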